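(* Let $A \in \mathbb{Z}^{m\times n}$ with $\operatorname{rank}(A)=m\ge 1$, $b\in\mathbb{Z}^m$, $c\in\mathbb{Z}^n$, and assume the integer program (IP) $\max\{c^\top z : Az=b,\ z\in\mathbb{Z}^n_{\ge 0}\}$ is feasible and bounded. Then for every optimal vertex solution $x^*$ of the linear relaxation (LP) $\max\{c^\top x : Ax=b,\ x\in\mathbb{R}^n_{\ge 0}\}$, there exists an optimal solution $z^*$ of (IP) such that \[ \|z^*-x^*\|_1 < 3m^2 \log\bigl(2\sqrt{m}\cdot \Delta^{1/m}\bigr)\cdot \Delta . \]
   Context: For $k\in\{1,\dots,m\}$, $\Delta_k(A)$ denotes the largest absolute value of the determinant of a $k\times k$ submatrix of $A$, and $\Delta:=\Delta_m(A)$. All logarithms $\log$ are base 2. *)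

theory Defs
  imports "HOL-Analysis.Analysis" "Jordan_Normal_Form.DL_Rank" "Jordan_Normal_Form.DL_Submatrix"
begin

definition Delta_k :: "int mat \<Rightarrow> nat \<Rightarrow> int" where
  "Delta_k A k = Max {\<bar>det (submatrix A I J)\<bar> | I J.
      I \<subseteq> {..<dim_row A} \<and> J \<subseteq> {..<dim_col A} \<and> card I = k \<and> card J = k}"

definition Delta :: "int mat \<Rightarrow> int" where
  "Delta A = Delta_k A (dim_row A)"

definition lp_feasible :: "int mat \<Rightarrow> int vec \<Rightarrow> real vec \<Rightarrow> bool" where
  "lp_feasible A b x \<longleftrightarrow> x \<in> carrier_vec (dim_col A) \<and>
     map_mat real_of_int A *\<^sub>v x = map_vec real_of_int b \<and> (\<forall>i<dim_col A. x $ i \<ge> 0)"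

definition ip_feasible :: "int mat \<Rightarrow> int vec \<Rightarrow> int vec \<Rightarrow> bool" where
  "ip_feasible A b z \<longleftrightarrow> z \<in> carrier_vec (dim_col A) \<and>
     A *\<^sub>v z = b \<and> (\<forall>i<dim_col A. z $ i \<ge> 0)"

definition lp_optimal :: "int mat \<Rightarrow> int vec \<Rightarrow> int vec \<Rightarrow> real vec \<Rightarrow> bool" where
  "lp_optimal A b c x \<longleftrightarrow> lp_feasible A b x \<and>
     (\<forall>y. lp_feasible A b y \<longrightarrow> map_vec real_of_int c \<bullet> y \<le> map_vec real_of_int c \<bullet> x)"

definition ip_optimal :: "int mat \<Rightarrow> int vec \<Rightarrow> int vec \<Rightarrow> int vec \<Rightarrow> bool" where
  "ip_optimal A b c z \<longleftrightarrow> ip_feasible A b z \<and>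
     (\<forall>w. ip_feasible A b w \<longrightarrow> c \<bullet> w \<le> c \<bullet> z)"

definition ip_bounded :: "int mat \<Rightarrow> int vec \<Rightarrow> int vec \<Rightarrow> bool" where
  "ip_bounded A b c \<longleftrightarrow> (\<exists>M. \<forall>z. ip_feasible A b z \<longrightarrow> c \<bullet> z \<le> M)"

definition lp_vertex :: "int mat \<Rightarrow> int vec \<Rightarrow> real vec \<Rightarrow> bool" where
  "lp_vertex A b x \<longleftrightarrow> lp_feasible A b x \<and>
     \<not> (\<exists>y w t. lp_feasible A b y \<and> lp_feasible A b w \<and> y \<noteq> w \<and> 0 < t \<and> t < 1 \<and>
            x = t \<cdot>\<^sub>v y + (1 - t) \<cdot>\<^sub>v w)"

definition l1_dist :: "int vec \<Rightarrow> real vec \<Rightarrow> real" where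
  "l1_dist z x = (\<Sum>i<dim_vec x. \<bar>real_of_int (z $ i) - x $ i\<bar>)"

end

theory Submission
  imports Defs "Jordan_Normal_Form.Matrix_Kernel"
begin

hide_const (open) Finite_Cartesian_Product.vec Finite_Cartesian_Product.mat
unbundle no vec_syntax

text \<open>
  Let \<open>z\<close> be an integer optimum of minimal support \<open>S\<close>, and \<open>s = |S|\<close>. The \<open>2^s\<close> subset sums of
  the columns in \<open>S\<close> are pairwise distinct, since otherwise \<open>z\<close> could be moved along a kernel vector
  with entries in \<open>{-1, 0, 1}\<close> until its support shrinks. In the coordinates given by a
  submatrix \<open>B\<close> with \<open>|det B| = \<Delta>\<close> all columns have entries in \<open>[-1, 1]\<close>, so the subset sums have
  variance at most \<open>s/4\<close> in each coordinate. On the other hand they lie in the preimage of \<open>\<int>\<^sup>m\<close>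
  under \<open>B\<close>, over which a product weight sums to at most \<open>\<Delta>\<close> times its largest sum over a translate
  of \<open>\<int>\<^sup>m\<close>. For a Gaussian weight, Jensen's inequality yields \<open>2^s \<le> \<Delta> (2e(s + 1))^(m/2)\<close>, whence
  \<open>s (m + 1) \<le> 3 m^2 log (2 sqrt m \<Delta>^(1/m))\<close>.

  The vector \<open>x* - z\<close> is a conformal nonnegative combination of at most \<open>s\<close> integral circuits,
  because the columns in the support of the vertex \<open>x*\<close> are independent. By Cramer's rule every
  circuit can be scaled to have \<open>l1\<close>-norm at most \<open>(m + 1) \<Delta>\<close>. Adding to \<open>z\<close> the combination with
  all coefficients rounded down gives a feasible point which is again optimal, as the opposite move
  is feasible from \<open>x*\<close>, and its distance to \<open>x*\<close> is less than \<open>s (m + 1) \<Delta>\<close>.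
\<close>

section \<open>Gaussian sums over translates of the integers\<close>

lemma sinh_le_mult_cosh:
  fixes x :: real
  assumes "x \<ge> 0"
  shows "sinh x \<le> x * cosh x"
proof -
  have "(\<lambda>y. y * cosh y - sinh y) 0 \<le> (\<lambda>y::real. y * cosh y - sinh y) x"
    by (rule DERIV_nonneg_imp_nondecreasing[OF assms])
       (auto intro!: exI derivative_eq_intros)
  then show ?thesis by simp
qed

lemma cosh_le_exp_half_square:
  fixes x :: real
  shows "cosh x \<le> exp (x\<^sup>2 / 2)"
proof -
  define h :: "real \<Rightarrow> real" where "h = (\<lambda>y. - (cosh y * exp (- y\<^sup>2 / 2)))"
  have "h 0 \<le> h \<bar>x\<bar>"
  proof (rule DERIV_nonneg_imp_nondecreasing[where f = h])
    fix y :: real assume y: "0 \<le> y"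
    have "(h has_real_derivative (y * cosh y - sinh y) * exp (- y\<^sup>2 / 2)) (at y)"
      unfolding h_def by (auto intro!: derivative_eq_intros simp: algebra_simps)
    then show "\<exists>d. (h has_real_derivative d) (at y) \<and> 0 \<le> d"
      using sinh_le_mult_cosh[OF y] by (intro exI conjI) auto
  qed simp
  then have "cosh x * exp (- x\<^sup>2 / 2) \<le> 1" by (simp add: h_def)
  then show ?thesis by (simp add: exp_minus field_simps)
qed

lemma tanh_diff:
  fixes x y :: real
  shows "tanh x - tanh y = sinh (x - y) / (cosh x * cosh y)"
  by (simp add: tanh_def sinh_diff field_simps)

lemma gaussian_le_tanh_increment:
  fixes r v :: real
  assumes "r \<ge> 0"
  shows "r * exp (- r\<^sup>2 / 4) * exp (- (r * v)\<^sup>2) \<le> tanh (r * (v + 1/2)) - tanh (r * (v - 1/2))"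
proof -
  have "cosh (r * (v + 1/2)) * cosh (r * (v - 1/2)) \<le>
      exp ((r * (v + 1/2))\<^sup>2 / 2) * exp ((r * (v - 1/2))\<^sup>2 / 2)"
    by (intro mult_mono cosh_le_exp_half_square) auto
  also have "\<dots> = exp (r\<^sup>2 / 4 + (r * v)\<^sup>2)"
    unfolding exp_add[symmetric] by (simp add: field_simps power2_eq_square)
  finally have cosh_le: "cosh (r * (v + 1/2)) * cosh (r * (v - 1/2)) \<le> exp (r\<^sup>2 / 4 + (r * v)\<^sup>2)" .
  have "- r\<^sup>2 / 4 + - (r * v)\<^sup>2 = - (r\<^sup>2 / 4 + (r * v)\<^sup>2)" by simp
  then have "r * exp (- r\<^sup>2 / 4) * exp (- (r * v)\<^sup>2) = r / exp (r\<^sup>2 / 4 + (r * v)\<^sup>2)"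
    by (metis divide_inverse exp_add exp_minus mult.assoc)
  also have "\<dots> \<le> sinh r / (cosh (r * (v + 1/2)) * cosh (r * (v - 1/2)))"
    using assms cosh_le real_le_x_sinh[of r]
    by (intro frac_le) (simp_all add: sinh_field_def exp_minus)
  also have "\<dots> = tanh (r * (v + 1/2)) - tanh (r * (v - 1/2))"
    unfolding tanh_diff by (simp add: algebra_simps)
  finally show ?thesis .
qed

lemma sum_increments_le:
  fixes f :: "int \<Rightarrow> real"
  assumes "finite K" and mono: "\<And>k. f k \<le> f (k + 1)" and bound: "\<And>k. \<bar>f k\<bar> \<le> c"
  shows "(\<Sum>k\<in>K. f (k + 1) - f k) \<le> 2 * c"
proof -
  have telescope: "(\<Sum>k\<in>{a..<a + int n}. f (k + 1) - f k) = f (a + int n) - f a" for a n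
  proof (induction n)
    case (Suc n)
    have "{a..<a + int (Suc n)} = insert (a + int n) {a..<a + int n}" by auto
    then show ?case using Suc by (simp add: algebra_simps)
  qed simp
  define a where "a = - (\<Sum>k\<in>K. \<bar>k\<bar>)"
  define n where "n = nat (1 - 2 * a)"
  have K: "K \<subseteq> {a..<a + int n}"
  proof
    fix k assume "k \<in> K"
    then have "\<bar>k\<bar> \<le> - a" unfolding a_def using assms(1) by (simp add: member_le_sum)
    then show "k \<in> {a..<a + int n}" by (auto simp: n_def)
  qed
  have "(\<Sum>k\<in>K. f (k + 1) - f k) \<le> (\<Sum>k\<in>{a..<a + int n}. f (k + 1) - f k)"
    using K mono by (intro sum_mono2) auto
  also have "\<dots> \<le> 2 * c" unfolding telescope using bound[of a] bound[of "a + int n"] by linarith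
  finally show ?thesis .
qed

definition translate_sums_le :: "(real \<Rightarrow> real) \<Rightarrow> real \<Rightarrow> bool" where
  "translate_sums_le g C \<longleftrightarrow> (\<forall>K t. finite K \<longrightarrow> (\<Sum>k\<in>K. g (of_int k + t)) \<le> C)"

lemma translate_sums_leD: "translate_sums_le g C \<Longrightarrow> finite K \<Longrightarrow> (\<Sum>k\<in>K. g (of_int k + t)) \<le> C"
  by (simp add: translate_sums_le_def)

lemma translate_sums_le_shift: "translate_sums_le g C \<Longrightarrow> translate_sums_le (\<lambda>x. g (x - a)) C"
  by (simp add: translate_sums_le_def add_diff_eq[symmetric])

lemma translate_sums_le_nonneg: "translate_sums_le g C \<Longrightarrow> 0 \<le> C"
  using translate_sums_leD[of g C "{}" 0] by simp

lemma translate_sums_le_gaussian: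
  fixes r :: real
  assumes "r > 0"
  shows "translate_sums_le (\<lambda>x. exp (- (r * x)\<^sup>2)) (2 / r * exp (r\<^sup>2 / 4))"
  unfolding translate_sums_le_def
proof (intro allI impI)
  fix K :: "int set" and t :: real
  assume K: "finite K"
  define f where "f k = tanh (r * (of_int k + t - 1/2))" for k :: int
  have gaussian_le: "r * exp (- r\<^sup>2 / 4) * exp (- (r * (of_int k + t))\<^sup>2) \<le> f (k + 1) - f k" for k
    using gaussian_le_tanh_increment[of r "of_int k + t"] assms by (simp add: f_def algebra_simps)
  have "r * exp (- r\<^sup>2 / 4) * (\<Sum>k\<in>K. exp (- (r * (of_int k + t))\<^sup>2)) \<le> (\<Sum>k\<in>K. f (k + 1) - f k)"
    unfolding sum_distrib_left by (rule sum_mono) (rule gaussian_le)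
  also have "\<dots> \<le> 2 * 1"
  proof (rule sum_increments_le[OF K])
    show "f k \<le> f (k + 1)" for k using assms by (simp add: f_def)
    show "\<bar>f k\<bar> \<le> 1" for k
      using tanh_real_bounds[of "r * (of_int k + t - 1/2)"]
      by (simp add: f_def abs_le_iff del: tanh_real_abs)
  qed
  finally show "(\<Sum>k\<in>K. exp (- (r * (of_int k + t))\<^sup>2)) \<le> 2 / r * exp (r\<^sup>2 / 4)"
    using assms by (simp add: exp_minus field_simps)
qed

lemma translate_sums_le_box:
  assumes "r \<ge> 0"
  shows "translate_sums_le (\<lambda>x. if \<bar>x\<bar> \<le> r then 1 else 0) (2 * r + 1)"
  unfolding translate_sums_le_def
proof (intro allI impI)
  fix K :: "int set" and t :: real
  assume "finite K"
  then have "(\<Sum>k\<in>K. if \<bar>of_int k + t\<bar> \<le> r then 1 else 0) = real (card {k \<in> K. \<bar>of_int k + t\<bar> \<le> r})"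
    by (simp add: sum.If_cases Int_def)
  also have "\<dots> \<le> real (card {\<lceil>- r - t\<rceil>..\<lfloor>r - t\<rfloor>})"
  proof (intro of_nat_mono card_mono subsetI)
    fix k assume "k \<in> {k \<in> K. \<bar>of_int k + t\<bar> \<le> r}"
    then have "- r - t \<le> of_int k" "of_int k \<le> r - t" by (auto simp: abs_le_iff)
    then show "k \<in> {\<lceil>- r - t\<rceil>..\<lfloor>r - t\<rfloor>}" by (simp add: ceiling_le_iff le_floor_iff)
  qed simp
  also have "\<dots> \<le> max 0 (of_int \<lfloor>r - t\<rfloor> - of_int \<lceil>- r - t\<rceil> + 1)" by simp
  also have "\<dots> \<le> 2 * r + 1" using assms by linarith
  finally show "(\<Sum>k\<in>K. if \<bar>of_int k + t\<bar> \<le> r then 1 else 0) \<le> 2 * r + 1" .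
qed

section \<open>Subset sums of a finite family of reals\<close>

definition centered_sum :: "('a \<Rightarrow> real) \<Rightarrow> 'a set \<Rightarrow> 'a set \<Rightarrow> real" where
  "centered_sum h S X = sum h X - sum h S / 2"

lemma centered_sum_eq_signed_sum:
  assumes "finite S" "X \<subseteq> S"
  shows "centered_sum h S X = (\<Sum>j\<in>S. (if j \<in> X then 1/2 else - 1/2) * h j)"
proof -
  have "(\<Sum>j\<in>S. (if j \<in> X then 1/2 else - 1/2) * h j) = (\<Sum>j\<in>S. (if j \<in> X then h j else 0) - h j / 2)"
    by (intro sum.cong) auto
  then show ?thesis
    using assms
    by (simp add: centered_sum_def sum_subtractf sum_divide_distrib Int_absorb1
        flip: sum.inter_restrict)
qed

lemma abs_centered_sum_le:
  assumes "finite S" "X \<subseteq> S" and "\<And>j. j \<in> S \<Longrightarrow> \<bar>h j\<bar> \<le> 1"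
  shows "\<bar>centered_sum h S X\<bar> \<le> real (card S) / 2"
proof -
  have "\<bar>centered_sum h S X\<bar> \<le> (\<Sum>j\<in>S. 1/2)"
    unfolding centered_sum_eq_signed_sum[OF assms(1,2)]
    by (rule order_trans[OF sum_abs sum_mono]) (use assms(3) in auto)
  then show ?thesis by simp
qed

lemma sum_Pow_centered_sum_square:
  assumes "finite S"
  shows "(\<Sum>X\<in>Pow S. (centered_sum h S X)\<^sup>2) = 2 ^ card S * (\<Sum>j\<in>S. (h j)\<^sup>2) / 4"
  using assms
proof (induction S rule: finite_induct)
  case empty
  then show ?case by (simp add: centered_sum_def)
next
  case (insert a S)
  let ?D = "centered_sum h S"
  have fresh: "finite X" "a \<notin> X" if "X \<in> Pow S" for X
    using that insert.hyps finite_subset by auto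
  have centered_old: "centered_sum h (insert a S) X = ?D X - h a / 2" for X
    using insert.hyps by (simp add: centered_sum_def add_divide_distrib)
  have centered_new: "centered_sum h (insert a S) (insert a X) = ?D X + h a / 2"
    if "X \<in> Pow S" for X
    using fresh[OF that] by (simp add: centered_old) (simp add: centered_sum_def)
  have "(\<Sum>X\<in>Pow (insert a S). (centered_sum h (insert a S) X)\<^sup>2) =
      (\<Sum>X\<in>Pow S. (?D X - h a / 2)\<^sup>2) + (\<Sum>X\<in>insert a ` Pow S. (centered_sum h (insert a S) X)\<^sup>2)"
    unfolding Pow_insert using insert.hyps by (subst sum.union_disjoint) (auto simp: centered_old)
  also have "(\<Sum>X\<in>insert a ` Pow S. (centered_sum h (insert a S) X)\<^sup>2) =
      (\<Sum>X\<in>Pow S. (?D X + h a / 2)\<^sup>2)"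
    using insert.hyps by (subst sum.reindex) (auto simp: inj_on_def centered_new intro!: sum.cong)
  also have "(\<Sum>X\<in>Pow S. (?D X - h a / 2)\<^sup>2) + \<dots> = (\<Sum>X\<in>Pow S. 2 * (?D X)\<^sup>2 + (h a)\<^sup>2 / 2)"
    unfolding sum.distrib[symmetric] by (intro sum.cong) (auto simp: power2_eq_square field_simps)
  also have "\<dots> = 2 * (\<Sum>X\<in>Pow S. (?D X)\<^sup>2) + 2 ^ card S * (h a)\<^sup>2 / 2"
    using insert.hyps by (simp add: sum.distrib sum_distrib_left card_Pow)
  finally show ?case using insert by (simp add: field_simps)
qed

lemma sum_Pow_centered_sum_square_le:
  assumes "finite S" and "\<And>j. j \<in> S \<Longrightarrow> \<bar>h j\<bar> \<le> 1"
  shows "(\<Sum>X\<in>Pow S. (centered_sum h S X)\<^sup>2) \<le> 2 ^ card S * (real (card S) / 4)"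
proof -
  have "(\<Sum>j\<in>S. (h j)\<^sup>2) \<le> (\<Sum>j\<in>S. 1)"
    using assms(2) by (intro sum_mono) (simp add: abs_square_le_1)
  then show ?thesis by (simp add: sum_Pow_centered_sum_square[OF assms(1)])
qed

lemma card_mult_exp_neg_le_sum:
  fixes Q :: "'a \<Rightarrow> real"
  assumes "finite P" and "(\<Sum>x\<in>P. Q x) \<le> real (card P) * q"
  shows "real (card P) * exp (- q) \<le> (\<Sum>x\<in>P. exp (- Q x))"
proof -
  have "real (card P) * exp (- q) \<le> exp (- q) * (\<Sum>x\<in>P. 1 + (q - Q x))"
    using assms by (simp add: sum.distrib sum_subtractf)
  also have "\<dots> \<le> (\<Sum>x\<in>P. exp (- q) * exp (q - Q x))"
    unfolding sum_distrib_left by (intro sum_mono mult_left_mono exp_ge_add_one_self) auto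
  finally show ?thesis by (simp flip: exp_add)
qed

section \<open>Weighted sums over the lattice of an integer matrix\<close>

abbreviation (input) of_int_mat :: "int mat \<Rightarrow> real mat" where "of_int_mat \<equiv> map_mat of_int"

abbreviation (input) of_int_vec :: "int vec \<Rightarrow> real vec" where "of_int_vec \<equiv> map_vec of_int"

lemma abs_det_single_entry_column:
  fixes B :: "'a::linordered_idom mat"
  assumes B: "B \<in> carrier_mat n n" and ij: "i < n" "j < n"
    and single: "\<And>k. k < n \<Longrightarrow> k \<noteq> i \<Longrightarrow> B $$ (k, j) = 0"
  shows "\<bar>det B\<bar> = \<bar>B $$ (i, j)\<bar> * \<bar>det (mat_delete B i j)\<bar>"
proof -
  have "det B = (\<Sum>k<n. B $$ (k, j) * cofactor B k j)"
    by (rule laplace_expansion_column[OF B ij(2)])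
  also have "\<dots> = (\<Sum>k\<in>{i}. B $$ (k, j) * cofactor B k j)"
    using ij(1) single by (intro sum.mono_neutral_right) auto
  finally show ?thesis by (simp add: cofactor_def abs_mult power_abs)
qed

lemma ex_nonzero_entry_in_column:
  fixes B :: "'a::comm_ring_1 mat"
  assumes B: "B \<in> carrier_mat n n" "det B \<noteq> 0" and j: "j < n"
  obtains i where "i < n" and "B $$ (i, j) \<noteq> 0"
proof -
  have "(\<Sum>i<n. B $$ (i, j) * cofactor B i j) \<noteq> 0"
    using B laplace_expansion_column[OF B(1) j] by simp
  then obtain i where "i \<in> {..<n}" "B $$ (i, j) * cofactor B i j \<noteq> 0"
    by (rule sum.not_neutral_contains_not_neutral)
  then show thesis by (intro that) auto
qed

lemma sum_abs_column_addrow_less: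
  fixes B :: "int mat"
  assumes B: "B \<in> carrier_mat m n" and kl: "k < m" "l < m" "k \<noteq> l" and j: "j < n"
    and le: "B $$ (l, j) \<noteq> 0" "\<bar>B $$ (l, j)\<bar> \<le> \<bar>B $$ (k, j)\<bar>"
  defines "c \<equiv> - (sgn (B $$ (k, j)) * sgn (B $$ (l, j)))"
  shows "(\<Sum>i<m. nat \<bar>addrow c k l B $$ (i, j)\<bar>) < (\<Sum>i<m. nat \<bar>B $$ (i, j)\<bar>)"
proof -
  have "\<bar>addrow c k l B $$ (k, j)\<bar> < \<bar>B $$ (k, j)\<bar>"
    using B kl j le by (auto simp: c_def sgn_if abs_if split: if_splits)
  then show ?thesis
    by (intro sum_strict_mono_ex1) (use B kl j in auto)
qed

text \<open>Row operations perform the Euclidean algorithm on the first column until a single nonzero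
  entry is left, whose row and column can then be split off.\<close>

lemma int_mat_row_reduce_induct [consumes 2, case_names dim_0 addrow delete]:
  fixes B :: "int mat"
  assumes "B \<in> carrier_mat m m" and "det B \<noteq> 0"
    and dim_0: "\<And>B. B \<in> carrier_mat 0 0 \<Longrightarrow> P 0 B"
    and addrow: "\<And>m B c k l. B \<in> carrier_mat m m \<Longrightarrow> k < m \<Longrightarrow> l < m \<Longrightarrow> k \<noteq> l \<Longrightarrow>
      P m (addrow c k l B) \<Longrightarrow> P m B"
    and delete: "\<And>m B i. B \<in> carrier_mat (Suc m) (Suc m) \<Longrightarrow> det B \<noteq> 0 \<Longrightarrow> i < Suc m \<Longrightarrow>
      (\<And>k. k < Suc m \<Longrightarrow> k \<noteq> i \<Longrightarrow> B $$ (k, 0) = 0) \<Longrightarrow> P m (mat_delete B i 0) \<Longrightarrow> P (Suc m) B"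
  shows "P m B"
  using assms(1,2)
proof (induction m arbitrary: B)
  case 0
  then show ?case by (intro dim_0)
next
  case (Suc m)
  show ?case using Suc.prems
  proof (induction "\<Sum>i<Suc m. nat \<bar>B $$ (i, 0)\<bar>" arbitrary: B rule: less_induct)
    case (less B)
    show ?case
    proof (cases "\<exists>k<Suc m. \<exists>l<Suc m. k \<noteq> l \<and> B $$ (l, 0) \<noteq> 0 \<and> \<bar>B $$ (l, 0)\<bar> \<le> \<bar>B $$ (k, 0)\<bar>")
      case True
      then obtain k l where kl: "k < Suc m" "l < Suc m" "k \<noteq> l" "B $$ (l, 0) \<noteq> 0"
        "\<bar>B $$ (l, 0)\<bar> \<le> \<bar>B $$ (k, 0)\<bar>" by blast
      define c where "c = - (sgn (B $$ (k, 0)) * sgn (B $$ (l, 0)))"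
      have "det (addrow c k l B) = det B"
        by (rule det_addrow[OF kl(2,3) less.prems(1)])
      then have "P (Suc m) (addrow c k l B)"
        using less.prems sum_abs_column_addrow_less[OF less.prems(1) kl(1-3) _ kl(4,5)]
        by (intro less.hyps) (auto simp: c_def)
      then show ?thesis using kl less.prems(1) by (intro addrow[of B "Suc m" k l c])
    next
      case False
      obtain i where i: "i < Suc m" "B $$ (i, 0) \<noteq> 0"
        using ex_nonzero_entry_in_column[OF less.prems, of 0] by blast
      have single: "B $$ (k, 0) = 0" if "k < Suc m" "k \<noteq> i" for k
        using False i that by (metis linorder_le_cases)
      have "det (mat_delete B i 0) \<noteq> 0"
        using abs_det_single_entry_column[OF less.prems(1) i(1) _ single] less.prems(2) by auto
      then have "P m (mat_delete B i 0)"
        using mat_delete_carrier[OF less.prems(1)] by (intro Suc.IH) auto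
      then show ?thesis using less.prems i(1) single by (intro delete)
    qed
  qed
qed

definition preimage_lattice :: "int mat \<Rightarrow> real vec set" where
  "preimage_lattice B = {w \<in> carrier_vec (dim_col B). \<forall>i<dim_row B. (of_int_mat B *\<^sub>v w) $ i \<in> \<int>}"

lemma preimage_lattice_addrow:
  assumes B: "B \<in> carrier_mat m n" and "k < m" "l < m" and w: "w \<in> preimage_lattice B"
  shows "w \<in> preimage_lattice (addrow c k l B)"
proof -
  have dim: "w \<in> carrier_vec n" using w B by (simp add: preimage_lattice_def)
  have "(of_int_mat (addrow c k l B) *\<^sub>v w) $ i \<in> \<int>" if i: "i < m" for i
  proof -
    have "(of_int_mat (addrow c k l B) *\<^sub>v w) $ i =
        (if i = k then of_int c * (of_int_mat B *\<^sub>v w) $ l else 0) + (of_int_mat B *\<^sub>v w) $ i"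
      using assms(2,3) B dim i
      by (auto simp: scalar_prod_def algebra_simps sum.distrib sum_distrib_left)
    then show ?thesis using w assms(2,3) B i by (auto simp: preimage_lattice_def)
  qed
  then show ?thesis using B dim by (simp add: preimage_lattice_def)
qed

lemma mult_mat_vec_vCons_index:
  fixes B :: "'a::comm_ring_1 mat"
  assumes "B \<in> carrier_mat m (Suc n)" "w \<in> carrier_vec n" "i < m"
  shows "(B *\<^sub>v vCons x w) $ i = B $$ (i, 0) * x + (\<Sum>j<n. B $$ (i, Suc j) * w $ j)"
  using assms
  by (simp add: scalar_prod_def atLeast0LessThan sum.lessThan_Suc_shift del: sum.lessThan_Suc)

lemma preimage_lattice_mat_delete:
  assumes B: "B \<in> carrier_mat (Suc m) (Suc m)"
    and single: "\<And>k. k < Suc m \<Longrightarrow> k \<noteq> i \<Longrightarrow> B $$ (k, 0) = 0"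
    and w: "vCons x w \<in> preimage_lattice B"
  shows "w \<in> preimage_lattice (mat_delete B i 0)"
proof -
  have dim: "w \<in> carrier_vec m" using w B by (simp add: preimage_lattice_def)
  have "(of_int_mat (mat_delete B i 0) *\<^sub>v w) $ k \<in> \<int>" if k: "k < m" for k
  proof -
    define k' where "k' = (if k < i then k else Suc k)"
    have k': "k' < Suc m" "k' \<noteq> i" using k by (auto simp: k'_def)
    have "(of_int_mat (mat_delete B i 0) *\<^sub>v w) $ k = (\<Sum>j<m. of_int (B $$ (k', Suc j)) * w $ j)"
      using B dim k by (simp add: scalar_prod_def mat_delete_def k'_def atLeast0LessThan)
    also have "\<dots> = (of_int_mat B *\<^sub>v vCons x w) $ k'"
      using mult_mat_vec_vCons_index[of "of_int_mat B" "Suc m" m w k' x] B dim k' single[OF k']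
      by simp
    finally show ?thesis using w B k' by (simp add: preimage_lattice_def)
  qed
  then show ?thesis using B dim by (simp add: preimage_lattice_def)
qed

lemma sum_preimage_integers_le:
  fixes g :: "real \<Rightarrow> real" and d :: int
  assumes "d \<noteq> 0" and Y: "finite Y" "\<And>y. y \<in> Y \<Longrightarrow> of_int d * y + s \<in> \<int>"
    and C: "translate_sums_le g C"
  shows "(\<Sum>y\<in>Y. g y) \<le> of_int \<bar>d\<bar> * C"
proof -
  have "\<forall>y\<in>Y. \<exists>k. of_int d * y + s = of_int k" using Y(2) by (auto elim: Ints_cases)
  then obtain k where k: "\<And>y. y \<in> Y \<Longrightarrow> of_int d * y + s = of_int (k y)" by metis
  define q where "q y = sgn d * (k y div \<bar>d\<bar>)" for y
  have y_eq: "y = of_int (q y) + (of_int (k y mod \<bar>d\<bar>) - s) / of_int d" if "y \<in> Y" for y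
  proof -
    have "k y = d * q y + k y mod \<bar>d\<bar>"
      by (simp add: q_def mult.assoc[symmetric] flip: abs_sgn)
    then have "of_int d * y + s = of_int d * of_int (q y) + of_int (k y mod \<bar>d\<bar>)"
      unfolding k[OF that] by (metis of_int_add of_int_mult)
    then show ?thesis using assms(1) by (simp add: field_simps)
  qed
  have class_le: "(\<Sum>y\<in>{y \<in> Y. k y mod \<bar>d\<bar> = r}. g y) \<le> C" for r
  proof -
    let ?Y = "{y \<in> Y. k y mod \<bar>d\<bar> = r}"
    have "inj_on q ?Y" using y_eq by (intro inj_onI) (metis (mono_tags, lifting) mem_Collect_eq)
    moreover have "(\<Sum>y\<in>?Y. g y) = (\<Sum>y\<in>?Y. g (of_int (q y) + (of_int r - s) / of_int d))"
      by (intro sum.cong arg_cong[where f = g]) (use y_eq in auto)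
    ultimately have "(\<Sum>y\<in>?Y. g y) = (\<Sum>j\<in>q ` ?Y. g (of_int j + (of_int r - s) / of_int d))"
      by (simp add: sum.reindex)
    then show ?thesis using translate_sums_leD[OF C, of "q ` ?Y"] Y(1) by simp
  qed
  have "(\<Sum>y\<in>Y. g y) = (\<Sum>r\<in>{0..<\<bar>d\<bar>}. \<Sum>y\<in>{y \<in> Y. k y mod \<bar>d\<bar> = r}. g y)"
    using Y(1) assms(1) by (intro sum.group[symmetric]) auto
  also have "\<dots> \<le> (\<Sum>r\<in>{0..<\<bar>d\<bar>}. C)" by (intro sum_mono class_le)
  finally show ?thesis by simp
qed

lemma sum_preimage_lattice_first_entry_le:
  fixes g :: "real \<Rightarrow> real"
  assumes B: "B \<in> carrier_mat m (Suc n)" "i < m" "B $$ (i, 0) \<noteq> 0"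
    and X: "finite X" "\<And>x. x \<in> X \<Longrightarrow> vCons x v \<in> preimage_lattice B"
    and C: "translate_sums_le g C"
  shows "(\<Sum>x\<in>X. g x) \<le> of_int \<bar>B $$ (i, 0)\<bar> * C"
proof (rule sum_preimage_integers_le[OF B(3) X(1)])
  fix x assume "x \<in> X"
  then have "vCons x v \<in> preimage_lattice B" by (rule X(2))
  then show "of_int (B $$ (i, 0)) * x + (\<Sum>j<n. of_int (B $$ (i, Suc j)) * v $ j) \<in> \<int>"
    using mult_mat_vec_vCons_index[of "of_int_mat B" m n v i x] B(1,2)
    by (auto simp: preimage_lattice_def simp del: index_mult_mat_vec)
qed (rule C)

lemma sum_over_vCons:
  fixes W :: "'a vec set" and f :: "'a vec \<Rightarrow> 'b::comm_monoid_add"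
  assumes "finite W" "W \<subseteq> carrier_vec (Suc n)"
  defines "V \<equiv> {v. \<exists>x. vCons x v \<in> W}"
  shows "finite V" and "finite {x. vCons x v \<in> W}"
    and "(\<Sum>w\<in>W. f w) = (\<Sum>v\<in>V. \<Sum>x\<in>{x. vCons x v \<in> W}. f (vCons x v))"
proof -
  let ?S = "SIGMA v:V. {x. vCons x v \<in> W}" and ?c = "\<lambda>(v, x). vCons x v"
  have inj: "inj_on ?c ?S" by (auto simp: inj_on_def)
  have image: "?c ` ?S = W"
  proof (intro equalityI subsetI)
    fix w assume w: "w \<in> W"
    then have "dim_vec w = Suc n" using assms(2) by auto
    then obtain x v where "w = vCons x v" by (cases w) auto
    then show "w \<in> ?c ` ?S" using w by (force simp: V_def)
  qed auto
  have fin: "finite ?S" using assms(1) image inj by (metis finite_imageD)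
  have "V = fst ` ?S" by (force simp: V_def)
  then show finV: "finite V" using fin by (metis finite_imageI)
  have fibre: "finite {x. vCons x v \<in> W}" for v
    using finite_vimageI[OF assms(1), of "\<lambda>x. vCons x v"] by (auto simp: vimage_def inj_def)
  then show "finite {x. vCons x v \<in> W}" .
  have "(\<Sum>w\<in>W. f w) = (\<Sum>(v, x)\<in>?S. f (vCons x v))"
    using sum.reindex[OF inj, of f] by (simp only: image) (simp add: case_prod_beta comp_def)
  then show "(\<Sum>w\<in>W. f w) = (\<Sum>v\<in>V. \<Sum>x\<in>{x. vCons x v \<in> W}. f (vCons x v))"
    using finV fibre by (simp add: sum.Sigma)
qed

lemma sum_prod_preimage_lattice_split_le:
  fixes g :: "nat \<Rightarrow> real \<Rightarrow> real"
  assumes B: "B \<in> carrier_mat (Suc m) (Suc m)" and i: "i < Suc m" "B $$ (i, 0) \<noteq> 0"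
    and single: "\<And>k. k < Suc m \<Longrightarrow> k \<noteq> i \<Longrightarrow> B $$ (k, 0) = 0"
    and W: "finite W" "W \<subseteq> preimage_lattice B"
    and g: "\<And>i t. 0 \<le> g i t"
    and C: "translate_sums_le (g 0) C"
    and minor: "\<And>V. finite V \<Longrightarrow> V \<subseteq> preimage_lattice (mat_delete B i 0) \<Longrightarrow>
      (\<Sum>v\<in>V. \<Prod>j<m. g (Suc j) (v $ j)) \<le> M"
  shows "(\<Sum>w\<in>W. \<Prod>j<Suc m. g j (w $ j)) \<le> of_int \<bar>B $$ (i, 0)\<bar> * C * M"
proof -
  let ?c = "of_int \<bar>B $$ (i, 0)\<bar> * C" and ?X = "\<lambda>v. {x. vCons x v \<in> W}"
  define V where "V = {v. \<exists>x. vCons x v \<in> W}"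
  define G where "G v = (\<Prod>j<m. g (Suc j) (v $ j))" for v :: "real vec"
  have "W \<subseteq> carrier_vec (Suc m)" using W(2) B by (auto simp: preimage_lattice_def)
  note sum_W = sum_over_vCons[OF W(1) this, folded V_def]
  have X_le: "(\<Sum>x\<in>?X v. g 0 x) \<le> ?c" for v
    using B i sum_W(2) W(2) C by (intro sum_preimage_lattice_first_entry_le) auto
  have V: "V \<subseteq> preimage_lattice (mat_delete B i 0)"
    using preimage_lattice_mat_delete[OF B single] W(2) by (auto simp: V_def)
  have "(\<Sum>w\<in>W. \<Prod>j<Suc m. g j (w $ j)) = (\<Sum>v\<in>V. (\<Sum>x\<in>?X v. g 0 x) * G v)"
    unfolding sum_W(3) sum_distrib_right
    by (simp add: prod.lessThan_Suc_shift G_def del: prod.lessThan_Suc)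
  also have "\<dots> \<le> (\<Sum>v\<in>V. ?c * G v)"
    by (intro sum_mono mult_right_mono X_le) (simp add: G_def g prod_nonneg)
  also have "\<dots> = ?c * (\<Sum>v\<in>V. G v)" by (simp add: sum_distrib_left)
  also have "\<dots> \<le> ?c * M"
    unfolding G_def using translate_sums_le_nonneg[OF C]
    by (intro mult_left_mono minor[OF sum_W(1) V]) simp
  finally show ?thesis .
qed

lemma sum_prod_preimage_lattice_le:
  fixes g :: "nat \<Rightarrow> real \<Rightarrow> real"
  assumes "B \<in> carrier_mat m m" and "det B \<noteq> 0"
    and "finite W" "W \<subseteq> preimage_lattice B"
    and "\<And>i t. 0 \<le> g i t"
    and "\<And>i. translate_sums_le (g i) (C i)"
  shows "(\<Sum>w\<in>W. \<Prod>i<m. g i (w $ i)) \<le> of_int \<bar>det B\<bar> * (\<Prod>i<m. C i)"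
  using assms
proof (induction m B arbitrary: W g C rule: int_mat_row_reduce_induct)
  case (dim_0 B)
  then have W: "W \<subseteq> carrier_vec 0" by (auto simp: preimage_lattice_def)
  have "v = w" if "v \<in> W" "w \<in> W" for v w
    using subsetD[OF W that(1)] subsetD[OF W that(2)] by (intro eq_vecI) auto
  then have "card W \<le> 1" using dim_0(2) by (simp add: card_le_Suc0_iff_eq)
  then show ?case using dim_0 by simp
next
  case (addrow m B c k l)
  then have "W \<subseteq> preimage_lattice (addrow c k l B)" by (blast intro: preimage_lattice_addrow)
  from addrow.IH[OF addrow.prems(1) this addrow.prems(3,4)] show ?case
    using det_addrow[OF addrow(3,4,1)] by simp
next
  case (delete m B i)
  note B = delete(1) and single = delete(4)
  note abs_det = abs_det_single_entry_column[OF B delete(3) _ single]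
  have "(\<Sum>w\<in>W. \<Prod>j<Suc m. g j (w $ j)) \<le>
      of_int \<bar>B $$ (i, 0)\<bar> * C 0 * (of_int \<bar>det (mat_delete B i 0)\<bar> * (\<Prod>j<m. C (Suc j)))"
  proof (rule sum_prod_preimage_lattice_split_le[OF B delete(3) _ single delete.prems(1,2)])
    show "B $$ (i, 0) \<noteq> 0" using abs_det delete(2) by auto
    show "(\<Sum>v\<in>V. \<Prod>j<m. g (Suc j) (v $ j)) \<le>
        of_int \<bar>det (mat_delete B i 0)\<bar> * (\<Prod>j<m. C (Suc j))"
      if "finite V" "V \<subseteq> preimage_lattice (mat_delete B i 0)" for V
      using that delete.prems(3,4) by (rule delete.IH)
  qed (use delete.prems(3,4) in auto)
  also have "\<dots> = of_int \<bar>det B\<bar> * (\<Prod>j<Suc m. C j)"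
    by (simp add: abs_det prod.lessThan_Suc_shift del: prod.lessThan_Suc of_int_abs)
  finally show ?case .
qed

section \<open>Maximal minors\<close>

definition select_cols :: "'a mat \<Rightarrow> (nat \<Rightarrow> nat) \<Rightarrow> 'a mat" where
  "select_cols A f = mat (dim_row A) (dim_row A) (\<lambda>(i, k). A $$ (i, f k))"

lemma select_cols_carrier [simp]: "A \<in> carrier_mat m n \<Longrightarrow> select_cols A f \<in> carrier_mat m m"
  by (auto simp: select_cols_def)

lemma select_cols_index [simp]:
  "A \<in> carrier_mat m n \<Longrightarrow> i < m \<Longrightarrow> k < m \<Longrightarrow> select_cols A f $$ (i, k) = A $$ (i, f k)"
  by (auto simp: select_cols_def)

lemma select_cols_cong:
  assumes "A \<in> carrier_mat m n" and "\<And>k. k < m \<Longrightarrow> f k = g k"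
  shows "select_cols A f = select_cols A g"
  using assms by (intro eq_matI) (auto simp: select_cols_def)

lemma inj_on_if_det_select_cols_nonzero:
  fixes A :: "'a::comm_ring_1 mat"
  assumes A: "A \<in> carrier_mat m n" and nonzero: "det (select_cols A f) \<noteq> 0"
  shows "inj_on f {..<m}"
proof (intro inj_onI, rule ccontr)
  fix k l assume kl: "k \<in> {..<m}" "l \<in> {..<m}" "f k = f l" "k \<noteq> l"
  have "col (select_cols A f) k = col (select_cols A f) l"
    using A kl by (intro eq_vecI) (auto simp: select_cols_def)
  then show False
    using nonzero det_identical_columns[OF select_cols_carrier[OF A], of k l] kl by auto
qed

lemma abs_det_select_cols_permute:
  fixes A :: "int mat"
  assumes A: "A \<in> carrier_mat m n" and p: "p permutes {0..<m}"
  shows "\<bar>det (select_cols A (f \<circ> p))\<bar> = \<bar>det (select_cols A f)\<bar>"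
proof -
  let ?B = "select_cols A f"
  have "p k < m" if "k < m" for k using permutes_in_image[OF p] that by auto
  then have "(select_cols A (f \<circ> p))\<^sup>T = mat m m (\<lambda>(k, i). ?B\<^sup>T $$ (p k, i))"
    using A by (intro eq_matI) (auto simp: select_cols_def)
  then have "det (select_cols A (f \<circ> p)) = det (mat m m (\<lambda>(k, i). ?B\<^sup>T $$ (p k, i)))"
    using A by (metis det_transpose[of _ m] select_cols_carrier)
  also have "\<dots> = signof p * det ?B\<^sup>T"
    using p A by (intro det_permute_rows) auto
  also have "det ?B\<^sup>T = det ?B" using A by (intro det_transpose[of _ m]) simp
  finally show ?thesis by (simp add: abs_mult sign_def comp_def)
qed

lemma submatrix_eq_select_cols:
  assumes A: "A \<in> carrier_mat m n" and J: "J \<subseteq> {..<n}" "card J = m"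
  shows "submatrix A {..<m} J = select_cols A (pick J)"
proof -
  have "{j. j < dim_col A \<and> j \<in> J} = J" "{i. i < dim_row A \<and> i \<in> {..<m}} = {..<m}"
    using A J by auto
  moreover have "pick {..<m} i = i" if "i < m" for i
  proof -
    have "{k \<in> {..<m}. k < i} = {..<i}" using that by auto
    then show ?thesis using pick_card_in_set[of i "{..<m}"] that by simp
  qed
  ultimately show ?thesis
    using A J by (intro eq_matI) (auto simp: submatrix_def select_cols_def)
qed

lemma Delta_eq_Max_select_cols:
  assumes A: "A \<in> carrier_mat m n"
  shows "Delta A = Max ((\<lambda>J. \<bar>det (select_cols A (pick J))\<bar>) ` {J. J \<subseteq> {..<n} \<and> card J = m})"
proof -
  have "{\<bar>det (submatrix A I J)\<bar> | I J.
      I \<subseteq> {..<m} \<and> J \<subseteq> {..<n} \<and> card I = m \<and> card J = m} =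
    (\<lambda>J. \<bar>det (submatrix A {..<m} J)\<bar>) ` {J. J \<subseteq> {..<n} \<and> card J = m}"
    (is "?L = ?R")
  proof
    show "?L \<subseteq> ?R" by (auto dest: card_subset_eq[rotated])
    show "?R \<subseteq> ?L" by fastforce
  qed
  also have "\<dots> = (\<lambda>J. \<bar>det (select_cols A (pick J))\<bar>) ` {J. J \<subseteq> {..<n} \<and> card J = m}"
    using submatrix_eq_select_cols[OF A] by (intro image_cong) auto
  finally show ?thesis using A by (simp add: Delta_def Delta_k_def)
qed

lemma ex_permutation_of_pick:
  assumes inj: "inj_on f {..<m}"
  obtains p where "p permutes {0..<m}" and "\<And>k. k < m \<Longrightarrow> f k = pick (f ` {..<m}) (p k)"
proof -
  define J where "J = f ` {..<m}"
  define p where "p k = (if k < m then card {j \<in> J. j < f k} else k)" for k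
  have J: "finite J" "card J = m" using inj by (auto simp: J_def card_image)
  have pick: "f k = pick J (p k)" if "k < m" for k
    using that pick_card_in_set[of "f k" J] by (simp add: p_def J_def)
  have "p permutes {0..<m}"
  proof (rule bij_imp_permutes)
    have "p k < m" if "k < m" for k
    proof -
      have "{j \<in> J. j < f k} \<subset> J" using that by (auto simp: J_def)
      then show ?thesis using psubset_card_mono[OF J(1)] J(2) that by (simp add: p_def)
    qed
    moreover have "inj_on p {0..<m}"
      using inj pick by (intro inj_onI) (metis atLeastLessThan_iff inj_on_def lessThan_iff)
    ultimately show "bij_betw p {0..<m} {0..<m}"
      by (intro bij_betw_imageI endo_inj_surj) auto
  qed (simp add: p_def)
  then show thesis using pick by (intro that) (auto simp: J_def)
qed

lemma abs_det_select_cols_le_Delta_if_inj: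
  fixes A :: "int mat"
  assumes A: "A \<in> carrier_mat m n" and f: "f \<in> {..<m} \<rightarrow> {..<n}" "inj_on f {..<m}"
  shows "\<bar>det (select_cols A f)\<bar> \<le> Delta A"
proof -
  obtain p where p: "p permutes {0..<m}" "\<And>k. k < m \<Longrightarrow> f k = pick (f ` {..<m}) (p k)"
    using ex_permutation_of_pick[OF f(2)] by blast
  have "select_cols A f = select_cols A (pick (f ` {..<m}) \<circ> p)"
    using p(2) by (intro select_cols_cong[OF A]) simp
  then have "\<bar>det (select_cols A f)\<bar> = \<bar>det (select_cols A (pick (f ` {..<m})))\<bar>"
    using abs_det_select_cols_permute[OF A p(1)] by simp
  also have "\<dots> \<le> Delta A"
    unfolding Delta_eq_Max_select_cols[OF A] using f by (intro Max_ge) (auto simp: card_image)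
  finally show ?thesis .
qed

lemma sum_select_cols_cramer:
  fixes A :: "'a::comm_ring_1 mat"
  assumes A: "A \<in> carrier_mat m n" and i: "i < m"
  shows "(\<Sum>k<m. A $$ (i, f k) * det (select_cols A (f(k := j)))) =
    det (select_cols A f) * A $$ (i, j)"
proof -
  let ?B = "select_cols A f" and ?a = "vec m (\<lambda>i. A $$ (i, j))"
  have B: "?B \<in> carrier_mat m m" using A by simp
  have adj: "(adj_mat ?B *\<^sub>v ?a) $ k = det (select_cols A (f(k := j)))" if k: "k < m" for k
  proof -
    let ?C = "select_cols A (f(k := j))"
    have C: "?C \<in> carrier_mat m m" using A by simp
    have "mat_delete ?C l k = mat_delete ?B l k" if "l < m" for l
      unfolding mat_delete_def using A k that by (intro eq_matI) (auto simp: select_cols_def)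
    then have "det ?C = (\<Sum>l<m. A $$ (l, j) * cofactor ?B l k)"
      unfolding laplace_expansion_column[OF C k] using A k by (simp add: cofactor_def)
    then show ?thesis using B k
      by (simp add: adj_mat_def scalar_prod_def atLeast0LessThan mult.commute)
  qed
  have "det ?B * A $$ (i, j) = ((?B * adj_mat ?B) *\<^sub>v ?a) $ i"
    unfolding adj_mat(2)[OF B] using i
    by (simp add: scalar_prod_def if_distrib if_distribR cong: if_cong)
  also have "\<dots> = (?B *\<^sub>v (adj_mat ?B *\<^sub>v ?a)) $ i"
    using B adj_mat(1)[OF B] by (subst assoc_mult_mat_vec) auto
  also have "\<dots> = (\<Sum>k<m. A $$ (i, f k) * (adj_mat ?B *\<^sub>v ?a) $ k)"
    using A i adj_mat(1)[OF B]
    by (subst index_mult_mat_vec) (auto simp: scalar_prod_def atLeast0LessThan select_cols_def)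
  finally show ?thesis by (simp add: adj)
qed

locale full_row_rank =
  fixes A :: "int mat" and m n :: nat
  assumes A_carrier: "A \<in> carrier_mat m n"
    and rank_A: "vec_space.rank m (of_int_mat A) = m"
begin

lemma of_int_A_carrier: "of_int_mat A \<in> carrier_mat m n"
  using A_carrier by simp

lemma ex_nonsingular_select_cols:
  obtains f where "f \<in> {..<m} \<rightarrow> {..<n}" and "det (select_cols A f) \<noteq> 0"
proof -
  interpret vec_space "TYPE(real)" m .
  let ?P = "\<lambda>T. T \<subseteq> set (cols (of_int_mat A)) \<and> lin_indpt T"
  obtain S where S: "maximal S ?P"
    using maximal_exists[of ?P "card (set (cols (of_int_mat A)))" "{}"]
    by (meson List.finite_set card_mono empty_iff empty_subsetI finite_lin_indpt2 rev_finite_subset)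
  have card_S: "card S = m" using rank_card_indpt[OF of_int_A_carrier S] rank_A by simp
  have sub: "S \<subseteq> set (cols (of_int_mat A))" and indpt: "lin_indpt S"
    using S by (auto simp: maximal_def)
  obtain us where us: "set us = S" "distinct us"
    using finite_distinct_list finite_subset[OF sub] by blast
  have len: "length us = m" using us card_S distinct_card by fastforce
  have "\<exists>j<n. us ! k = col (of_int_mat A) j" if "k < m" for k
  proof -
    have "us ! k \<in> set (cols (of_int_mat A))" using sub us len that by auto
    then show ?thesis using A_carrier by (auto simp: in_set_conv_nth)
  qed
  then obtain f where f: "\<And>k. k < m \<Longrightarrow> f k < n" "\<And>k. k < m \<Longrightarrow> us ! k = col (of_int_mat A) (f k)"
    by metis
  let ?B = "of_int_mat (select_cols A f)"
  have B: "?B \<in> carrier_mat m m" using A_carrier by simp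
  have "cols ?B = us"
    using f A_carrier len by (intro nth_equalityI) (auto intro!: eq_vecI simp: select_cols_def)
  then have "rank ?B = m"
    using B us indpt by (intro lin_indpt_full_rank) auto
  then have "det (select_cols A f) \<noteq> 0" using det_rank_iff[OF B] by simp
  then show thesis using f(1) by (intro that) auto
qed

lemma Delta_pos: "Delta A > 0"
  using ex_nonsingular_select_cols abs_det_select_cols_le_Delta_if_inj[OF A_carrier]
    inj_on_if_det_select_cols_nonzero[OF A_carrier]
  by (metis abs_le_zero_iff linorder_not_less order.trans)

lemma abs_det_select_cols_le_Delta:
  assumes "f \<in> {..<m} \<rightarrow> {..<n}"
  shows "\<bar>det (select_cols A f)\<bar> \<le> Delta A"
  using abs_det_select_cols_le_Delta_if_inj[OF A_carrier assms]
    inj_on_if_det_select_cols_nonzero[OF A_carrier, of f] Delta_pos by fastforce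

lemma ex_select_cols_eq_Delta:
  obtains f where "f \<in> {..<m} \<rightarrow> {..<n}" and "\<bar>det (select_cols A f)\<bar> = Delta A"
proof -
  let ?F = "{J. J \<subseteq> {..<n} \<and> card J = m}"
  obtain f where f: "f \<in> {..<m} \<rightarrow> {..<n}" "det (select_cols A f) \<noteq> 0"
    by (rule ex_nonsingular_select_cols)
  have "f ` {..<m} \<in> ?F"
    using f inj_on_if_det_select_cols_nonzero[OF A_carrier] by (auto simp: card_image)
  then have "Delta A \<in> (\<lambda>J. \<bar>det (select_cols A (pick J))\<bar>) ` ?F"
    unfolding Delta_eq_Max_select_cols[OF A_carrier] by (intro Max_in) auto
  then obtain J where J: "J \<subseteq> {..<n}" "card J = m" "\<bar>det (select_cols A (pick J))\<bar> = Delta A"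
    by auto
  show thesis using J pick_in_set_le[of _ J] by (intro that[of "pick J"]) auto
qed

end

section \<open>Columns with distinct subset sums\<close>

definition distinct_subset_sums :: "int mat \<Rightarrow> nat set \<Rightarrow> bool" where
  "distinct_subset_sums A S \<longleftrightarrow> inj_on (\<lambda>X. A *\<^sub>v vec (dim_col A) (indicator X)) (Pow S)"

lemma mult_mat_vec_indicator_index:
  fixes A :: "'a::comm_ring_1 mat"
  assumes "A \<in> carrier_mat m n" "X \<subseteq> {..<n}" "i < m"
  shows "(A *\<^sub>v vec n (indicator X)) $ i = (\<Sum>j\<in>X. A $$ (i, j))"
proof -
  have "{..<n} \<inter> X = X" using assms(2) by auto
  then show ?thesis
    using assms
    by (simp add: scalar_prod_def atLeast0LessThan indicator_def if_distrib cong: if_cong)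
qed

context full_row_rank
begin

definition cramer_coord :: "(nat \<Rightarrow> nat) \<Rightarrow> nat \<Rightarrow> nat \<Rightarrow> real" where
  "cramer_coord f i j = of_int (det (select_cols A (f(i := j)))) / of_int (det (select_cols A f))"

lemma abs_cramer_coord_le_1:
  assumes "f \<in> {..<m} \<rightarrow> {..<n}" "\<bar>det (select_cols A f)\<bar> = Delta A" "j < n"
  shows "\<bar>cramer_coord f i j\<bar> \<le> 1"
proof -
  have "\<bar>det (select_cols A (f(i := j)))\<bar> \<le> \<bar>det (select_cols A f)\<bar>"
    unfolding assms(2) using assms by (intro abs_det_select_cols_le_Delta) auto
  then have "real_of_int \<bar>det (select_cols A (f(i := j)))\<bar> \<le> of_int \<bar>det (select_cols A f)\<bar>"
    by (simp only: of_int_le_iff)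
  then show ?thesis using assms(2) Delta_pos by (auto simp: cramer_coord_def)
qed

lemma sum_mult_cramer_coord:
  assumes "det (select_cols A f) \<noteq> 0" "i < m"
  shows "(\<Sum>k<m. of_int (A $$ (i, f k)) * cramer_coord f k j) = of_int (A $$ (i, j))"
proof -
  have "(\<Sum>k<m. of_int (A $$ (i, f k)) * cramer_coord f k j) =
      of_int (\<Sum>k<m. A $$ (i, f k) * det (select_cols A (f(k := j)))) /
        of_int (det (select_cols A f))"
    by (simp add: cramer_coord_def sum_divide_distrib)
  then show ?thesis using assms by (simp only: sum_select_cols_cramer[OF A_carrier]) simp
qed

lemma select_cols_mult_cramer_coord_sum:
  assumes "det (select_cols A f) \<noteq> 0" "X \<subseteq> {..<n}"
  shows "of_int_mat (select_cols A f) *\<^sub>v vec m (\<lambda>k. sum (cramer_coord f k) X) =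
    of_int_vec (A *\<^sub>v vec n (indicator X))" (is "?B *\<^sub>v ?w = of_int_vec ?s")
proof (rule eq_vecI)
  fix i assume "i < dim_vec (of_int_vec ?s)"
  then have i: "i < m" using A_carrier by simp
  then have "(?B *\<^sub>v ?w) $ i = (\<Sum>k<m. \<Sum>j\<in>X. of_int (A $$ (i, f k)) * cramer_coord f k j)"
    using A_carrier by (simp add: scalar_prod_def atLeast0LessThan select_cols_def sum_distrib_left)
  also have "\<dots> = (\<Sum>j\<in>X. of_int (A $$ (i, j)))"
    by (subst sum.swap) (simp add: sum_mult_cramer_coord[OF assms(1) i])
  also have "\<dots> = of_int (?s $ i)"
    using i by (subst mult_mat_vec_indicator_index[OF A_carrier assms(2)]) auto
  finally show "(?B *\<^sub>v ?w) $ i = of_int_vec ?s $ i"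
    using A_carrier i by simp
qed (use A_carrier in \<open>simp add: select_cols_def\<close>)

lemma sum_weights_subset_sums_le:
  fixes g :: "real \<Rightarrow> real"
  assumes det: "det (select_cols A f) \<noteq> 0"
    and S: "S \<subseteq> {..<n}" "distinct_subset_sums A S"
    and g: "\<And>t. 0 \<le> g t" and C: "translate_sums_le g C"
  shows "(\<Sum>X\<in>Pow S. \<Prod>i<m. g (centered_sum (cramer_coord f i) S X))
    \<le> of_int \<bar>det (select_cols A f)\<bar> * C ^ m"
proof -
  let ?B = "select_cols A f"
  define w where "w X = vec m (\<lambda>k. sum (cramer_coord f k) X)" for X
  define \<mu> where "\<mu> i = sum (cramer_coord f i) S / 2" for i
  have B_w: "of_int_mat ?B *\<^sub>v w X = of_int_vec (A *\<^sub>v vec n (indicator X))"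
    if "X \<subseteq> S" for X
    unfolding w_def using that S(1) by (intro select_cols_mult_cramer_coord_sum[OF det]) auto
  have inj: "inj_on w (Pow S)"
  proof (rule inj_onI)
    fix X Y assume XY: "X \<in> Pow S" "Y \<in> Pow S" "w X = w Y"
    then have "of_int_vec (A *\<^sub>v vec n (indicator X)) = of_int_vec (A *\<^sub>v vec n (indicator Y))"
      using B_w by (metis PowD)
    then have "A *\<^sub>v vec n (indicator X) = A *\<^sub>v vec n (indicator Y)"
      by (rule of_int_hom.vec_hom_inj)
    then show "X = Y"
      using S(2) XY(1,2) A_carrier by (auto simp: distinct_subset_sums_def dest: inj_onD)
  qed
  have "w ` Pow S \<subseteq> preimage_lattice ?B"
    using B_w A_carrier
    by (auto simp: preimage_lattice_def w_def select_cols_def simp del: index_mult_mat_vec)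
  then have "(\<Sum>v\<in>w ` Pow S. \<Prod>i<m. g (v $ i - \<mu> i)) \<le> of_int \<bar>det ?B\<bar> * (\<Prod>i<m. C)"
    using det A_carrier finite_subset[OF S(1)] g translate_sums_le_shift[OF C]
    by (intro sum_prod_preimage_lattice_le) auto
  then show ?thesis
    unfolding sum.reindex[OF inj] by (simp add: w_def \<mu>_def centered_sum_def)
qed

lemma distinct_subset_sums_box_bound:
  assumes S: "S \<subseteq> {..<n}" "distinct_subset_sums A S"
  shows "2 ^ card S \<le> real_of_int (Delta A) * (real (card S) + 1) ^ m"
proof -
  let ?s = "real (card S)"
  define g :: "real \<Rightarrow> real" where "g = (\<lambda>t. if \<bar>t\<bar> \<le> ?s / 2 then 1 else 0)"
  obtain f where f: "f \<in> {..<m} \<rightarrow> {..<n}" "\<bar>det (select_cols A f)\<bar> = Delta A"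
    by (rule ex_select_cols_eq_Delta)
  have finite: "finite S" using S(1) finite_subset by blast
  have "\<bar>centered_sum (cramer_coord f i) S X\<bar> \<le> ?s / 2" if "X \<subseteq> S" for X i
    using finite that abs_cramer_coord_le_1[OF f] S(1) by (intro abs_centered_sum_le) auto
  then have "(2::real) ^ card S = (\<Sum>X\<in>Pow S. \<Prod>i<m. g (centered_sum (cramer_coord f i) S X))"
    using finite by (simp add: g_def card_Pow)
  also have "\<dots> \<le> of_int \<bar>det (select_cols A f)\<bar> * (?s + 1) ^ m"
  proof (rule sum_weights_subset_sums_le[OF _ S])
    show "translate_sums_le g (?s + 1)"
      using translate_sums_le_box[of "?s / 2"] by (simp add: g_def)
  qed (use f Delta_pos in \<open>auto simp: g_def\<close>)
  finally show ?thesis by (simp only: f(2))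
qed

lemma gaussian_width_constant:
  fixes s :: real
  assumes "s \<ge> 0"
  defines "r \<equiv> sqrt (2 / (s + 1))"
  shows "2 / r * (exp (r\<^sup>2 / 4) * exp (r\<^sup>2 * s / 4)) = sqrt (2 * exp 1 * (s + 1))"
proof -
  have r: "r > 0" "r\<^sup>2 = 2 / (s + 1)" using assms(1) by (simp_all add: r_def)
  have "r\<^sup>2 * (s + 1) = 2" using assms(1) by (simp add: r(2) divide_eq_eq)
  then have "r\<^sup>2 / 4 + r\<^sup>2 * s / 4 = 1 / 2" by (simp add: algebra_simps)
  then have "exp (r\<^sup>2 / 4) * exp (r\<^sup>2 * s / 4) = exp (1 / 2)" by (simp flip: exp_add)
  moreover have "(2 / r * exp (1 / 2))\<^sup>2 = 2 * exp 1 * (s + 1)"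
    by (simp add: power_mult_distrib power_divide r(2) flip: exp_double)
  ultimately show ?thesis using r(1) by (simp add: real_sqrt_unique)
qed

lemma distinct_subset_sums_gaussian_bound:
  assumes S: "S \<subseteq> {..<n}" "distinct_subset_sums A S"
  shows "2 ^ card S \<le> real_of_int (Delta A) * sqrt (2 * exp 1 * (real (card S) + 1)) ^ m"
proof -
  let ?s = "real (card S)"
  define r where "r = sqrt (2 / (?s + 1))"
  have r: "r > 0" by (simp add: r_def add_nonneg_pos)
  obtain f where f: "f \<in> {..<m} \<rightarrow> {..<n}" "\<bar>det (select_cols A f)\<bar> = Delta A"
    by (rule ex_select_cols_eq_Delta)
  have finite: "finite S" using S(1) finite_subset by blast
  define h where "h X i = centered_sum (cramer_coord f i) S X" for X i
  have "(\<Sum>X\<in>Pow S. \<Sum>i<m. (r * h X i)\<^sup>2) = (\<Sum>i<m. r\<^sup>2 * (\<Sum>X\<in>Pow S. (h X i)\<^sup>2))"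
    unfolding power_mult_distrib by (subst sum.swap) (simp only: sum_distrib_left)
  also have "\<dots> \<le> (\<Sum>i<m. r\<^sup>2 * (2 ^ card S * (?s / 4)))"
    unfolding h_def using finite abs_cramer_coord_le_1[OF f] S(1)
    by (intro sum_mono mult_left_mono sum_Pow_centered_sum_square_le) auto
  also have "\<dots> = real (card (Pow S)) * (real m * (r\<^sup>2 * ?s / 4))"
    using finite by (simp add: card_Pow)
  finally have "real (card (Pow S)) * exp (- (real m * (r\<^sup>2 * ?s / 4))) \<le>
      (\<Sum>X\<in>Pow S. exp (- (\<Sum>i<m. (r * h X i)\<^sup>2)))"
    using finite by (intro card_mult_exp_neg_le_sum) auto
  also have "\<dots> = (\<Sum>X\<in>Pow S. \<Prod>i<m. exp (- (r * h X i)\<^sup>2))"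
    by (simp add: exp_sum flip: sum_negf)
  also have "\<dots> \<le> of_int \<bar>det (select_cols A f)\<bar> * (2 / r * exp (r\<^sup>2 / 4)) ^ m"
    unfolding h_def using f Delta_pos translate_sums_le_gaussian[OF r]
    by (intro sum_weights_subset_sums_le[OF _ S]) auto
  finally have "2 ^ card S \<le>
      of_int (Delta A) * ((2 / r * exp (r\<^sup>2 / 4)) ^ m * exp (real m * (r\<^sup>2 * ?s / 4)))"
    using finite by (simp add: f(2) card_Pow exp_minus field_simps)
  also have "(2 / r * exp (r\<^sup>2 / 4)) ^ m * exp (real m * (r\<^sup>2 * ?s / 4)) =
      (2 / r * (exp (r\<^sup>2 / 4) * exp (r\<^sup>2 * ?s / 4))) ^ m"
    unfolding exp_of_nat_mult power_mult_distrib by (simp only: mult.assoc)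
  also have "2 / r * (exp (r\<^sup>2 / 4) * exp (r\<^sup>2 * ?s / 4)) = sqrt (2 * exp 1 * (?s + 1))"
    unfolding r_def by (rule gaussian_width_constant) simp
  finally show ?thesis .
qed

end

section \<open>The sparsity bound\<close>

lemma cube_le_8_mult_power_2: "(real s + 1) ^ 3 \<le> 8 * 2 ^ s"
proof (cases "s < 3")
  case True
  then have "s = 0 \<or> s = 1 \<or> s = 2" by auto
  then show ?thesis by auto
next
  case False
  then have "3 \<le> s" by simp
  then show ?thesis
  proof (induction s rule: dec_induct)
    case (step s)
    have "2 * (real s + 1) ^ 3 - (real (Suc s) + 1) ^ 3 =
        (real s - 3) * ((real s)\<^sup>2 + 3 * real s + 3) + 3"
      by (simp add: power3_eq_cube power2_eq_square algebra_simps)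
    also have "\<dots> \<ge> 0" using step.hyps by (intro add_nonneg_nonneg mult_nonneg_nonneg) auto
    finally show ?case using step.IH by simp
  qed simp
qed

lemma le_log_if_box_bound:
  fixes D :: real
  assumes "D \<ge> 1" and box: "2 ^ s \<le> D * (real s + 1)"
  shows "2 * real s \<le> 3 * log 2 (2 * D)"
proof -
  have "2 ^ s * 2 ^ (2 * s) = ((2::real) ^ s) ^ 3"
    by (simp flip: power_mult power_add)
  also have "\<dots> \<le> (D * (real s + 1)) ^ 3" by (rule power_mono[OF box]) simp
  also have "\<dots> \<le> D ^ 3 * (8 * 2 ^ s)"
    unfolding power_mult_distrib using assms(1) cube_le_8_mult_power_2
    by (intro mult_left_mono) auto
  also have "\<dots> = 2 ^ s * (2 * D) ^ 3" by (simp add: power_mult_distrib)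
  finally have "2 ^ (2 * s) \<le> (2 * D) ^ 3" by simp
  then have "log 2 (2 ^ (2 * s)) \<le> log 2 ((2 * D) ^ 3)"
    using assms(1) by (subst log_le_cancel_iff) auto
  then show ?thesis using assms(1) log_nat_power[of "2 * D" 2 3] by simp
qed

lemma exp_1_mult_affine_le_powr:
  fixes t M :: real
  assumes "t \<ge> 2" "M \<ge> 2"
  shows "2 * exp 1 * (M * t + 1) \<le> 4 * M * 2 powr t"
proof -
  have "2 * exp 1 * (M * t + 1) \<le> 2 * (272 / 100) * (M * (t + 1 / 2))"
    using assms e_less_272 by (intro mult_mono) (auto simp: field_simps)
  also have "\<dots> \<le> 4 * M * (4 * (1 + (t - 2) * (2 / 3)))"
    using mult_left_mono[of 2 t M] assms by (simp add: field_simps)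
  also have "\<dots> \<le> 4 * M * (4 * exp ((t - 2) * ln 2))"
  proof -
    have "1 + (t - 2) * (2 / 3) \<le> 1 + (t - 2) * ln 2"
      using assms ln2_ge_two_thirds by (intro add_left_mono mult_left_mono) auto
    also have "\<dots> \<le> exp ((t - 2) * ln 2)" by (rule exp_ge_add_one_self)
    finally show ?thesis using assms(2) by (intro mult_left_mono) simp_all
  qed
  also have "4 * exp ((t - 2) * ln 2) = 2 powr t"
  proof -
    have "exp ((t - 2) * ln 2) = 2 powr (t - 2)" by (simp add: powr_def)
    then show ?thesis using powr_diff[of 2 t 2] by simp
  qed
  finally show ?thesis .
qed

definition log_factor :: "nat \<Rightarrow> real \<Rightarrow> real" where
  "log_factor m D = log 2 (2 * sqrt (real m) * D powr (1 / real m))"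

lemma log_factor_ge_1:
  assumes "m \<ge> 1" "D \<ge> 1"
  shows "log_factor m D \<ge> 1"
proof -
  have "2 * 1 * 1 \<le> 2 * sqrt (real m) * D powr (1 / real m)"
    using assms by (intro mult_mono ge_one_powr_ge_zero) auto
  then have "log 2 2 \<le> log_factor m D"
    unfolding log_factor_def by (subst log_le_cancel_iff) auto
  then show ?thesis by simp
qed

lemma powr_log_factor:
  assumes "m \<ge> 1" "D \<ge> 1"
  shows "2 powr log_factor m D = 2 * sqrt (real m) * D powr (1 / real m)"
  unfolding log_factor_def using assms by (intro powr_log_cancel) auto

lemma le_log_factor_if_gaussian_bound:
  assumes "m \<ge> 2" "D \<ge> 1" and gauss: "2 ^ s \<le> D * sqrt (2 * exp 1 * (real s + 1)) ^ m"
  shows "real s \<le> 2 * real m * log_factor m D"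
proof -
  define t where "t = real s / real m"
  have s: "real s = real m * t" using assms(1) by (simp add: t_def)
  have "t \<le> 2 * log_factor m D"
  proof (cases "t \<le> 2")
    case True
    then show ?thesis using log_factor_ge_1[of m D] assms(1,2) by simp
  next
    case False
    let ?E = "2 * exp 1 * (real s + 1)"
    have "2 powr t = (2 ^ s) powr (1 / real m)" by (simp add: t_def powr_powr flip: powr_realpow)
    also have "\<dots> \<le> (D * sqrt ?E ^ m) powr (1 / real m)" using gauss by (intro powr_mono2) auto
    also have "\<dots> = D powr (1 / real m) * sqrt ?E"
      using assms(1,2) by (simp add: powr_mult powr_powr flip: powr_realpow)
    finally have "(2 powr t)\<^sup>2 \<le> (D powr (1 / real m) * sqrt ?E)\<^sup>2" by (rule power_mono) simp
    also have "\<dots> = (D powr (1 / real m))\<^sup>2 * ?E" by (simp add: power_mult_distrib)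
    also have "\<dots> \<le> (D powr (1 / real m))\<^sup>2 * (4 * real m * 2 powr t)"
      unfolding s using False assms(1) by (intro mult_left_mono exp_1_mult_affine_le_powr) auto
    also have "\<dots> = (2 powr log_factor m D)\<^sup>2 * 2 powr t"
      using assms(1,2) by (simp add: powr_log_factor power_mult_distrib)
    finally have "2 powr t \<le> (2 powr log_factor m D)\<^sup>2" by (simp add: power2_eq_square)
    also have "\<dots> = 2 powr (2 * log_factor m D)" by (simp add: power2_eq_square flip: powr_add)
    finally show ?thesis by simp
  qed
  then have "real m * t \<le> real m * (2 * log_factor m D)" by (rule mult_left_mono) simp
  then show ?thesis unfolding s by simp
qed

text \<open>For \<open>m = 1\<close> the Gaussian bound is slightly too weak.\<close>

lemma (in full_row_rank) card_distinct_subset_sums_le: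
  assumes "m \<ge> 1" "S \<subseteq> {..<n}" "distinct_subset_sums A S"
  shows "real (card S) * (real m + 1) \<le> 3 * real m ^ 2 * log_factor m (Delta A)"
proof -
  have Delta: "real_of_int (Delta A) \<ge> 1" using Delta_pos by simp
  show ?thesis
  proof (cases "m = 1")
    case True
    then show ?thesis
      using le_log_if_box_bound[OF Delta, of "card S"] Delta
        distinct_subset_sums_box_bound[OF assms(2,3)]
      by (simp add: log_factor_def)
  next
    case False
    then have "m \<ge> 2" using assms(1) by simp
    let ?L = "log_factor m (Delta A)"
    have "real (card S) * (real m + 1) \<le> 2 * real m * ?L * (real m + 1)"
      using distinct_subset_sums_gaussian_bound[OF assms(2,3)] Delta \<open>m \<ge> 2\<close>
      by (intro mult_right_mono le_log_factor_if_gaussian_bound) auto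
    also have "\<dots> = ?L * (2 * real m * (real m + 1))" by simp
    also have "\<dots> \<le> ?L * (3 * real m ^ 2)"
      using \<open>m \<ge> 2\<close> log_factor_ge_1[OF assms(1) Delta]
      by (intro mult_left_mono) (auto simp: power2_eq_square algebra_simps)
    finally show ?thesis by (simp add: mult.commute)
  qed
qed

section \<open>Kernel vectors, supports and conformality\<close>

definition vec_support :: "'a::zero vec \<Rightarrow> nat set" where
  "vec_support v = {j. j < dim_vec v \<and> v $ j \<noteq> 0}"

lemma finite_vec_support [simp]: "finite (vec_support v)"
  by (simp add: vec_support_def)

lemma in_vec_support_iff: "v \<in> carrier_vec n \<Longrightarrow> j \<in> vec_support v \<longleftrightarrow> j < n \<and> v $ j \<noteq> 0"
  by (auto simp: vec_support_def)

lemma vec_support_empty_iff: "v \<in> carrier_vec n \<Longrightarrow> vec_support v = {} \<longleftrightarrow> v = 0\<^sub>v n"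
  by (auto simp: vec_support_def)

definition indep_cols :: "'a::comm_ring_1 mat \<Rightarrow> nat set \<Rightarrow> bool" where
  "indep_cols A J \<longleftrightarrow> (\<forall>v\<in>mat_kernel A. vec_support v \<subseteq> J \<longrightarrow> v = 0\<^sub>v (dim_col A))"

lemma indep_cols_mono: "indep_cols A J \<Longrightarrow> I \<subseteq> J \<Longrightarrow> indep_cols A I"
  by (auto simp: indep_cols_def)

definition conformal :: "'a::linordered_idom vec \<Rightarrow> 'a vec \<Rightarrow> bool" where
  "conformal u d \<longleftrightarrow> dim_vec u = dim_vec d \<and> (\<forall>j<dim_vec d. u $ j \<noteq> 0 \<longrightarrow> 0 < u $ j * d $ j)"

definition conformal_le :: "real vec \<Rightarrow> real vec \<Rightarrow> bool" where
  "conformal_le u d \<longleftrightarrow> dim_vec u = dim_vec d \<and> (\<forall>j<dim_vec d. u $ j \<in> closed_segment 0 (d $ j))"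

lemma in_closed_segment_0_iff:
  fixes x y :: real
  shows "x \<in> closed_segment 0 y \<longleftrightarrow> 0 \<le> x \<and> x \<le> y \<or> y \<le> x \<and> x \<le> 0"
  by (auto simp: closed_segment_eq_real_ivl)

lemma conformal_le_trans: "conformal_le u v \<Longrightarrow> conformal_le v w \<Longrightarrow> conformal_le u w"
  unfolding conformal_le_def by (metis ends_in_segment(1) subset_closed_segment subsetD)

lemma conformal_le_if_conformal:
  assumes "conformal u d" and "\<And>j. j < dim_vec d \<Longrightarrow> \<bar>u $ j\<bar> \<le> \<bar>d $ j\<bar>"
  shows "conformal_le u d"
  unfolding conformal_le_def
proof (intro conjI allI impI)
  fix j assume j: "j < dim_vec d"
  then have "u $ j = 0 \<or> 0 < u $ j * d $ j" using assms(1) by (auto simp: conformal_def)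
  then show "u $ j \<in> closed_segment 0 (d $ j)"
    using assms(2)[OF j] by (auto simp: in_closed_segment_0_iff zero_less_mult_iff)
qed (use assms(1) in \<open>simp add: conformal_def\<close>)

definition l1_norm :: "'a::linordered_idom vec \<Rightarrow> 'a" where
  "l1_norm v = (\<Sum>j<dim_vec v. \<bar>v $ j\<bar>)"

lemma mat_kernel_sum:
  fixes A :: "'a::comm_ring_1 mat"
  assumes A: "A \<in> carrier_mat m n" and v: "\<And>t. t \<in> T \<Longrightarrow> v t \<in> mat_kernel A"
  shows "vec n (\<lambda>j. \<Sum>t\<in>T. c t * v t $ j) \<in> mat_kernel A"
proof (rule mat_kernelI[OF A])
  let ?s = "vec n (\<lambda>j. \<Sum>t\<in>T. c t * v t $ j)"
  show "A *\<^sub>v ?s = 0\<^sub>v m"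
  proof (rule eq_vecI)
    fix i assume "i < dim_vec (0\<^sub>v m)"
    then have i: "i < m" by simp
    have zero: "(\<Sum>j<n. A $$ (i, j) * v t $ j) = 0" if "t \<in> T" for t
    proof -
      have "(A *\<^sub>v v t) $ i = 0" using mat_kernelD[OF A v[OF that]] i by simp
      then show ?thesis
        using A i mat_kernelD(1)[OF A v[OF that]] by (simp add: scalar_prod_def atLeast0LessThan)
    qed
    have "(A *\<^sub>v ?s) $ i = (\<Sum>j<n. \<Sum>t\<in>T. c t * (A $$ (i, j) * v t $ j))"
      using A i by (simp add: scalar_prod_def atLeast0LessThan sum_distrib_left mult.left_commute)
    also have "\<dots> = (\<Sum>t\<in>T. c t * (\<Sum>j<n. A $$ (i, j) * v t $ j))"
      by (subst sum.swap) (simp add: sum_distrib_left)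
    finally show "(A *\<^sub>v ?s) $ i = 0\<^sub>v m $ i" using zero i by simp
  qed (use A in simp)
qed simp

lemma mat_kernel_diff_smult:
  fixes A :: "'a::comm_ring_1 mat"
  assumes A: "A \<in> carrier_mat m n" and v: "v \<in> mat_kernel A" and w: "w \<in> mat_kernel A"
  shows "v - c \<cdot>\<^sub>v w \<in> mat_kernel A"
  using mat_kernelD[OF A v] mat_kernelD[OF A mat_kernel_smult[OF A w]]
  by (intro mat_kernelI[OF A]) (auto simp: mult_minus_distrib_mat_vec[OF A])

lemma of_int_vec_in_mat_kernel:
  assumes A: "A \<in> carrier_mat m n" and u: "u \<in> mat_kernel A"
  shows "of_int_vec u \<in> mat_kernel (of_int_mat A)"
  using mat_kernelD[OF A u] A of_int_hom.mult_mat_vec_hom[OF A, of u, symmetric]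
  by (intro mat_kernelI[of _ m n]) (auto simp: of_int_hom.vec_hom_zero)

lemma ex_maximal_step:
  fixes d w :: "'a::linordered_field vec"
  assumes "dim_vec w = dim_vec d" and "vec_support w \<noteq> {}"
  obtains k t where "k \<in> vec_support w" and "d $ k = t * w $ k"
    and "\<And>j. j < dim_vec d \<Longrightarrow> \<bar>t * w $ j\<bar> \<le> \<bar>d $ j\<bar>"
proof -
  obtain k where k: "is_arg_min (\<lambda>j. \<bar>d $ j / w $ j\<bar>) (\<lambda>j. j \<in> vec_support w) k"
    using ex_is_arg_min_if_finite[OF finite_vec_support assms(2)] by blast
  define t where "t = d $ k / w $ k"
  have "\<bar>t * w $ j\<bar> \<le> \<bar>d $ j\<bar>" if "j < dim_vec d" for j
  proof (cases "w $ j = 0")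
    case False
    then have "\<bar>t\<bar> \<le> \<bar>d $ j / w $ j\<bar>"
      using k that assms(1) by (simp add: is_arg_min_linorder t_def vec_support_def)
    then show ?thesis using False by (simp add: abs_mult field_simps)
  qed simp
  moreover have "k \<in> vec_support w" using k by (simp add: is_arg_min_linorder)
  moreover from this have "d $ k = t * w $ k" by (simp add: t_def vec_support_def)
  ultimately show thesis by (intro that)
qed

lemma kernel_vec_eq_sum_fundamental_circuits:
  fixes A :: "'a::field mat"
  assumes A: "A \<in> carrier_mat m n" and "finite T" and indep: "indep_cols A (J - T)"
    and u: "u \<in> mat_kernel A" "vec_support u \<subseteq> J"
    and w: "\<And>t. t \<in> T \<Longrightarrow> w t \<in> mat_kernel A" "\<And>t. t \<in> T \<Longrightarrow> vec_support (w t) \<subseteq> J - (T - {t})"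
      "\<And>t. t \<in> T \<Longrightarrow> w t $ t \<noteq> 0"
    and j: "j < n"
  shows "u $ j = (\<Sum>t\<in>T. u $ t / w t $ t * w t $ j)"
proof -
  define v where "v = u - 1 \<cdot>\<^sub>v vec n (\<lambda>j. \<Sum>t\<in>T. u $ t / w t $ t * w t $ j)"
  have v: "v \<in> mat_kernel A"
    unfolding v_def using u(1) w(1) by (intro mat_kernel_diff_smult[OF A] mat_kernel_sum[OF A])
  have v_index: "v $ i = u $ i - (\<Sum>t\<in>T. u $ t / w t $ t * w t $ i)" if "i < n" for i
    using that by (simp add: v_def)
  have w_0: "w t $ i = 0" if "t \<in> T" "i < n" "i \<notin> J - (T - {t})" for t i
    using w(2)[OF that(1)] that(2,3) in_vec_support_iff[OF mat_kernelD(1)[OF A w(1)[OF that(1)]]]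
    by blast
  have "v $ i = 0" if i: "i < n" "i \<notin> J - T" for i
  proof (cases "i \<in> T")
    case True
    have "(\<Sum>t\<in>T. u $ t / w t $ t * w t $ i) = (\<Sum>t\<in>{i}. u $ t / w t $ t * w t $ i)"
      using True assms(2) w_0[OF _ i(1)] by (intro sum.mono_neutral_right) auto
    then show ?thesis using w(3)[OF True] by (simp add: v_index[OF i(1)])
  next
    case False
    then have "u $ i = 0" using i u in_vec_support_iff[OF mat_kernelD(1)[OF A u(1)]] by blast
    then show ?thesis using False i w_0[OF _ i(1)] by (simp add: v_index[OF i(1)])
  qed
  then have "vec_support v \<subseteq> J - T" using in_vec_support_iff[OF mat_kernelD(1)[OF A v]] by blast
  then have "v = 0\<^sub>v n" using indep v A by (simp add: indep_cols_def)
  then show ?thesis using v_index[OF j] j by simp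
qed

text \<open>Otherwise every \<open>t \<in> T\<close> has a fundamental circuit that avoids \<open>k\<close>; since these span the kernel
  vectors supported in \<open>J\<close>, also \<open>u\<close> would vanish at \<open>k\<close>.\<close>

lemma indep_cols_exchange:
  fixes A :: "'a::field mat"
  assumes A: "A \<in> carrier_mat m n" and "finite T" and indep: "indep_cols A (J - T)"
    and u: "u \<in> mat_kernel A" "vec_support u \<subseteq> J" and k: "k \<in> vec_support u"
  obtains t where "t \<in> T" and "indep_cols A (J - {k} - (T - {t}))"
proof -
  have "\<exists>t\<in>T. indep_cols A (J - {k} - (T - {t}))"
  proof (rule ccontr)
    assume "\<not> ?thesis"
    then have "\<exists>w. w \<in> mat_kernel A \<and> vec_support w \<subseteq> J - {k} - (T - {t}) \<and> w \<noteq> 0\<^sub>v n"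
      if "t \<in> T" for t
      using that A by (auto simp: indep_cols_def)
    then obtain w where w: "\<And>t. t \<in> T \<Longrightarrow> w t \<in> mat_kernel A"
      "\<And>t. t \<in> T \<Longrightarrow> vec_support (w t) \<subseteq> J - {k} - (T - {t})" "\<And>t. t \<in> T \<Longrightarrow> w t \<noteq> 0\<^sub>v n"
      by metis
    have "w t $ t \<noteq> 0" if "t \<in> T" for t
    proof
      assume "w t $ t = 0"
      then have "vec_support (w t) \<subseteq> J - T" using w(2)[OF that] by (auto simp: vec_support_def)
      then show False using indep w(1,3)[OF that] A by (auto simp: indep_cols_def)
    qed
    moreover have "k < n" "u $ k \<noteq> 0"
      using k in_vec_support_iff[OF mat_kernelD(1)[OF A u(1)]] by auto
    ultimately have "u $ k = (\<Sum>t\<in>T. u $ t / w t $ t * w t $ k)"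
      using w by (intro kernel_vec_eq_sum_fundamental_circuits[OF A assms(2) indep u]) auto
    moreover have "w t $ k = 0" if "t \<in> T" for t
      using w(2)[OF that] \<open>k < n\<close> in_vec_support_iff[OF mat_kernelD(1)[OF A w(1)[OF that]]] by blast
    ultimately show False using \<open>u $ k \<noteq> 0\<close> by simp
  qed
  then show thesis using that by blast
qed

lemma conformal_support_reduction:
  fixes A :: "'a::linordered_field mat"
  assumes A: "A \<in> carrier_mat m n" and v: "v \<in> mat_kernel A" "conformal v d"
    and w: "w \<in> mat_kernel A" "w \<noteq> 0\<^sub>v n" "vec_support w \<subseteq> vec_support v"
  obtains t where "conformal (v - t \<cdot>\<^sub>v w) d" and "vec_support (v - t \<cdot>\<^sub>v w) \<subset> vec_support v"
proof -
  note dim = mat_kernelD(1)[OF A v(1)] mat_kernelD(1)[OF A w(1)]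
  have "vec_support w \<noteq> {}" using vec_support_empty_iff[OF dim(2)] w(2) by simp
  moreover have "dim_vec w = dim_vec v" using dim by simp
  ultimately obtain k t where k: "k \<in> vec_support w" "v $ k = t * w $ k"
    and le: "\<And>j. j < dim_vec v \<Longrightarrow> \<bar>t * w $ j\<bar> \<le> \<bar>v $ j\<bar>"
    using ex_maximal_step by metis
  have "conformal (v - t \<cdot>\<^sub>v w) d"
    unfolding conformal_def
  proof (intro conjI allI impI)
    fix i assume "i < dim_vec d" "(v - t \<cdot>\<^sub>v w) $ i \<noteq> 0"
    then have i: "i < n" "v $ i - t * w $ i \<noteq> 0" using v dim by (auto simp: conformal_def)
    then have "v $ i = 0 \<or> 0 < v $ i * d $ i" using v dim by (auto simp: conformal_def)
    then have "0 < (v $ i - t * w $ i) * d $ i"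
      using le[of i] i dim by (auto simp: zero_less_mult_iff abs_if split: if_splits)
    then show "0 < (v - t \<cdot>\<^sub>v w) $ i * d $ i" using dim i by simp
  qed (use v(2) dim in \<open>simp add: conformal_def\<close>)
  moreover have "vec_support (v - t \<cdot>\<^sub>v w) \<subset> vec_support v"
  proof -
    have "k \<in> vec_support v - vec_support (v - t \<cdot>\<^sub>v w)"
      using k w(3) dim by (auto simp: vec_support_def)
    moreover have "vec_support (v - t \<cdot>\<^sub>v w) \<subseteq> vec_support v"
      using le dim by (force simp: vec_support_def)
    ultimately show ?thesis by blast
  qed
  ultimately show thesis by (rule that)
qed

lemma ex_conformal_elementary:
  fixes A :: "'a::linordered_field mat"
  assumes A: "A \<in> carrier_mat m n" and d: "d \<in> mat_kernel A" "d \<noteq> 0\<^sub>v n"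
  obtains v j where "v \<in> mat_kernel A" and "conformal v d" and "j \<in> vec_support v"
    and "indep_cols A (vec_support v - {j})"
proof -
  let ?P = "\<lambda>v. v \<in> mat_kernel A \<and> v \<noteq> 0\<^sub>v n \<and> conformal v d"
  have "?P d" using d by (auto simp: conformal_def zero_less_mult_iff)
  then obtain v where v: "?P v" and min: "\<And>w. ?P w \<Longrightarrow> card (vec_support v) \<le> card (vec_support w)"
    using ex_has_least_nat[of ?P d "\<lambda>v. card (vec_support v)"] by blast
  have dim: "v \<in> carrier_vec n" using v mat_kernelD(1)[OF A] by blast
  obtain j where j: "j \<in> vec_support v" using v vec_support_empty_iff[OF dim] by blast
  have "w = 0\<^sub>v n" if w: "w \<in> mat_kernel A" "vec_support w \<subseteq> vec_support v - {j}" for w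
  proof (rule ccontr)
    assume "w \<noteq> 0\<^sub>v n"
    then obtain t where t: "conformal (v - t \<cdot>\<^sub>v w) d" "vec_support (v - t \<cdot>\<^sub>v w) \<subset> vec_support v"
      using conformal_support_reduction[OF A] v w by (metis Diff_subset order.trans)
    have "w $ j = 0" "v $ j \<noteq> 0" "j < n"
      using j w(2) in_vec_support_iff[OF dim] in_vec_support_iff[OF mat_kernelD(1)[OF A w(1)]]
      by blast+
    then have "v - t \<cdot>\<^sub>v w \<noteq> 0\<^sub>v n"
      using dim mat_kernelD(1)[OF A w(1)] by (auto dest!: arg_cong[of _ _ "\<lambda>v. v $ j"])
    then have "card (vec_support v) \<le> card (vec_support (v - t \<cdot>\<^sub>v w))"
      using v w(1) t(1) by (intro min) (blast intro: mat_kernel_diff_smult[OF A])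
    then show False using psubset_card_mono[OF _ t(2)] by simp
  qed
  then have "indep_cols A (vec_support v - {j})" using A by (simp add: indep_cols_def)
  then show thesis using v j that by blast
qed

section \<open>Integral circuits\<close>

context full_row_rank
begin

lemma indep_cols_basis:
  assumes f: "f \<in> {..<m} \<rightarrow> {..<n}" and det: "det (select_cols A f) \<noteq> 0"
  shows "indep_cols (of_int_mat A) (f ` {..<m})"
  unfolding indep_cols_def
proof (intro ballI impI)
  fix v assume v: "v \<in> mat_kernel (of_int_mat A)" "vec_support v \<subseteq> f ` {..<m}"
  note dim = mat_kernelD(1)[OF of_int_A_carrier v(1)]
  let ?B = "of_int_mat (select_cols A f)" and ?v = "vec m (\<lambda>k. v $ f k)"
  have inj: "inj_on f {..<m}" by (rule inj_on_if_det_select_cols_nonzero[OF A_carrier det])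
  have "?B *\<^sub>v ?v = 0\<^sub>v m"
  proof (rule eq_vecI)
    fix i assume "i < dim_vec (0\<^sub>v m)"
    then have i: "i < m" by simp
    have "(?B *\<^sub>v ?v) $ i = (\<Sum>j\<in>f ` {..<m}. of_int (A $$ (i, j)) * v $ j)"
      using A_carrier i
      by (simp add: sum.reindex[OF inj] scalar_prod_def atLeast0LessThan select_cols_def)
    also have "\<dots> = (\<Sum>j<n. of_int (A $$ (i, j)) * v $ j)"
      using f v(2) in_vec_support_iff[OF dim] by (intro sum.mono_neutral_left) auto
    also have "\<dots> = (of_int_mat A *\<^sub>v v) $ i"
      using A_carrier dim i by (simp add: scalar_prod_def atLeast0LessThan)
    finally show "(?B *\<^sub>v ?v) $ i = 0\<^sub>v m $ i"
      using mat_kernelD(2)[OF of_int_A_carrier v(1)] by simp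
  qed (use A_carrier in \<open>simp add: select_cols_def\<close>)
  moreover have "?B \<in> carrier_mat m m" "det ?B \<noteq> 0" using A_carrier det by simp_all
  ultimately have "?v = 0\<^sub>v m" using det_0_iff_vec_prod_zero_field[of ?B m] vec_carrier by blast
  then have "v $ f k = 0" if "k < m" for k using that by (metis index_vec index_zero_vec(1))
  then have "vec_support v = {}" using v(2) by (auto simp: vec_support_def)
  then show "v = 0\<^sub>v (dim_col (of_int_mat A))" using vec_support_empty_iff[OF dim] A_carrier by simp
qed

definition cramer_circuit :: "(nat \<Rightarrow> nat) \<Rightarrow> nat \<Rightarrow> int vec" where
  "cramer_circuit f j = vec n (\<lambda>l. (if l = j then det (select_cols A f) else 0) -
     (\<Sum>k<m. if f k = l then det (select_cols A (f(k := j))) else 0))"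

lemma cramer_circuit_in_mat_kernel:
  assumes f: "f \<in> {..<m} \<rightarrow> {..<n}" and j: "j < n"
  shows "cramer_circuit f j \<in> mat_kernel A"
proof (rule mat_kernelI[OF A_carrier])
  let ?d = "\<lambda>k. det (select_cols A (f(k := j)))"
  show "A *\<^sub>v cramer_circuit f j = 0\<^sub>v m"
  proof (rule eq_vecI)
    fix i assume "i < dim_vec (0\<^sub>v m)"
    then have i: "i < m" by simp
    have "(A *\<^sub>v cramer_circuit f j) $ i = (\<Sum>l<n. A $$ (i, l) * cramer_circuit f j $ l)"
      using A_carrier i by (simp add: scalar_prod_def cramer_circuit_def atLeast0LessThan)
    also have "\<dots> = (\<Sum>l<n. (if l = j then A $$ (i, j) * det (select_cols A f) else 0) -
        (\<Sum>k<m. if f k = l then A $$ (i, f k) * ?d k else 0))"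
      by (intro sum.cong)
         (auto simp: cramer_circuit_def right_diff_distrib sum_distrib_left intro!: sum.cong)
    also have "\<dots> = A $$ (i, j) * det (select_cols A f) -
        (\<Sum>l<n. \<Sum>k<m. if f k = l then A $$ (i, f k) * ?d k else 0)"
      using j by (simp add: sum_subtractf)
    also have "(\<Sum>l<n. \<Sum>k<m. if f k = l then A $$ (i, f k) * ?d k else 0) =
        (\<Sum>k<m. A $$ (i, f k) * ?d k)"
      using f by (subst sum.swap, intro sum.cong) auto
    finally show "(A *\<^sub>v cramer_circuit f j) $ i = 0\<^sub>v m $ i"
      using i j sum_select_cols_cramer[OF A_carrier i, of f j] by simp
  qed (use A_carrier in simp)
qed (simp add: cramer_circuit_def)

lemma vec_support_cramer_circuit:
  "vec_support (cramer_circuit f j) \<subseteq>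
    insert j (f ` {k \<in> {..<m}. det (select_cols A (f(k := j))) \<noteq> 0})"
proof
  fix l assume l: "l \<in> vec_support (cramer_circuit f j)"
  show "l \<in> insert j (f ` {k \<in> {..<m}. det (select_cols A (f(k := j))) \<noteq> 0})"
  proof (rule ccontr)
    assume "\<not> ?thesis"
    then have "l \<noteq> j" "(\<Sum>k<m. if f k = l then det (select_cols A (f(k := j))) else 0) = 0"
      by (auto intro!: sum.neutral)
    then show False using l by (auto simp: cramer_circuit_def vec_support_def)
  qed
qed

lemma cramer_circuit_index_self:
  assumes "j < n" "j \<notin> f ` {..<m}"
  shows "cramer_circuit f j $ j = det (select_cols A f)"
proof -
  have "(\<Sum>k<m. if f k = j then det (select_cols A (f(k := j))) else 0) = 0"
    using assms(2) by (intro sum.neutral) auto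
  then show ?thesis using assms(1) by (simp add: cramer_circuit_def)
qed

lemma l1_norm_cramer_circuit_le:
  assumes f: "f \<in> {..<m} \<rightarrow> {..<n}" and j: "j < n"
  shows "l1_norm (cramer_circuit f j) \<le> (int m + 1) * Delta A"
proof -
  let ?d = "\<lambda>k. det (select_cols A (f(k := j)))"
  have "l1_norm (cramer_circuit f j) \<le>
      (\<Sum>l<n. (if l = j then \<bar>det (select_cols A f)\<bar> else 0) +
        (\<Sum>k<m. if f k = l then \<bar>?d k\<bar> else 0))"
    unfolding l1_norm_def cramer_circuit_def dim_vec
  proof (rule sum_mono)
    fix l assume "l \<in> {..<n}"
    moreover have "\<bar>\<Sum>k<m. if f k = l then ?d k else 0\<bar> \<le> (\<Sum>k<m. if f k = l then \<bar>?d k\<bar> else 0)"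
      by (rule order_trans[OF sum_abs]) (auto intro!: sum_mono)
    ultimately show "\<bar>vec n (\<lambda>l. (if l = j then det (select_cols A f) else 0) -
        (\<Sum>k<m. if f k = l then ?d k else 0)) $ l\<bar> \<le>
        (if l = j then \<bar>det (select_cols A f)\<bar> else 0) + (\<Sum>k<m. if f k = l then \<bar>?d k\<bar> else 0)"
      by auto
  qed
  also have "\<dots> = \<bar>det (select_cols A f)\<bar> + (\<Sum>l<n. \<Sum>k<m. if f k = l then \<bar>?d k\<bar> else 0)"
    using j by (simp add: sum.distrib)
  also have "(\<Sum>l<n. \<Sum>k<m. if f k = l then \<bar>?d k\<bar> else 0) = (\<Sum>k<m. \<bar>?d k\<bar>)"
    using f by (subst sum.swap, intro sum.cong) auto
  also have "\<bar>det (select_cols A f)\<bar> + (\<Sum>k<m. \<bar>?d k\<bar>) \<le> Delta A + (\<Sum>k<m. Delta A)"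
    using f j by (intro add_mono sum_mono abs_det_select_cols_le_Delta) auto
  finally show ?thesis by (simp add: algebra_simps)
qed

lemma ex_exchange_into_basis:
  assumes f: "f \<in> {..<m} \<rightarrow> {..<n}" "det (select_cols A f) \<noteq> 0"
    and J: "indep_cols (of_int_mat A) J" and j: "j \<in> J" "j < n" "j \<notin> f ` {..<m}"
  obtains k where "k < m" and "f k \<notin> J" and "det (select_cols A (f(k := j))) \<noteq> 0"
proof -
  have "\<exists>k<m. f k \<notin> J \<and> det (select_cols A (f(k := j))) \<noteq> 0"
  proof (rule ccontr)
    assume "\<not> ?thesis"
    then have "vec_support (of_int_vec (cramer_circuit f j)) \<subseteq> J"
      using vec_support_cramer_circuit[of f j] j(1) by (auto simp: vec_support_def)
    then have "of_int_vec (cramer_circuit f j) = 0\<^sub>v n"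
      using of_int_vec_in_mat_kernel[OF A_carrier cramer_circuit_in_mat_kernel[OF f(1) j(2)]]
        J A_carrier
      by (simp add: indep_cols_def)
    then have "cramer_circuit f j = 0\<^sub>v n" by simp
    then show False using cramer_circuit_index_self[OF j(2,3)] f(2) j(2) by simp
  qed
  then show thesis using that by blast
qed

lemma indep_cols_extends_to_basis:
  assumes J: "J \<subseteq> {..<n}" "indep_cols (of_int_mat A) J"
  obtains f where "f \<in> {..<m} \<rightarrow> {..<n}" and "det (select_cols A f) \<noteq> 0" and "J \<subseteq> f ` {..<m}"
proof -
  let ?P = "\<lambda>f. f \<in> {..<m} \<rightarrow> {..<n} \<and> det (select_cols A f) \<noteq> 0"
    and ?c = "\<lambda>f. card (J \<inter> f ` {..<m})"
  have finite: "finite J" using J(1) finite_subset by blast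
  obtain f0 where "?P f0" using ex_nonsingular_select_cols by blast
  moreover have "\<forall>f. ?P f \<longrightarrow> ?c f < Suc (card J)"
    using finite by (auto intro: card_mono simp: less_Suc_eq_le)
  ultimately obtain f where f: "?P f" and max: "\<And>g. ?P g \<Longrightarrow> ?c g \<le> ?c f"
    using ex_has_greatest_nat[of ?P f0 ?c "Suc (card J)"] by blast
  have "J \<subseteq> f ` {..<m}"
  proof (rule ccontr)
    assume "\<not> J \<subseteq> f ` {..<m}"
    then obtain j where j: "j \<in> J" "j \<notin> f ` {..<m}" by blast
    then have "j < n" using J(1) by auto
    then obtain k where k: "k < m" "f k \<notin> J" "det (select_cols A (f(k := j))) \<noteq> 0"
      using ex_exchange_into_basis[OF _ _ J(2) j(1) _ j(2)] f by blast
    have "Suc (?c f) = card (insert j (J \<inter> f ` {..<m}))"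
      using finite j by simp
    also have "\<dots> \<le> ?c (f(k := j))"
      using finite j k by (intro card_mono) auto
    also have "\<dots> \<le> ?c f" using f k \<open>j < n\<close> by (intro max) auto
    finally show False by simp
  qed
  then show thesis using f that by blast
qed

lemma cramer_circuit_eq_smult:
  assumes f: "f \<in> {..<m} \<rightarrow> {..<n}" "det (select_cols A f) \<noteq> 0"
    and v: "v \<in> mat_kernel (of_int_mat A)" "vec_support v \<subseteq> insert j (f ` {..<m})"
    and j: "j < n" "j \<notin> f ` {..<m}" "v $ j \<noteq> 0"
  shows "of_int_vec (cramer_circuit f j) = (of_int (det (select_cols A f)) / v $ j) \<cdot>\<^sub>v v"
proof -
  note w = cramer_circuit_in_mat_kernel[OF f(1) j(1)]
  note dim = mat_kernelD(1)[OF A_carrier w] mat_kernelD(1)[OF of_int_A_carrier v(1)]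
  define c where "c = of_int (det (select_cols A f)) / v $ j"
  define x where "x = of_int_vec (cramer_circuit f j) - c \<cdot>\<^sub>v v"
  have x: "x \<in> mat_kernel (of_int_mat A)"
    unfolding x_def using of_int_vec_in_mat_kernel[OF A_carrier w] v(1)
    by (rule mat_kernel_diff_smult[OF of_int_A_carrier])
  have x_index: "x $ l = of_int (cramer_circuit f j $ l) - c * v $ l" if "l < n" for l
    using that dim by (simp add: x_def)
  have "l \<in> f ` {..<m}" if "l \<in> vec_support x" for l
  proof -
    have "l < n" "x $ l \<noteq> 0"
      using that in_vec_support_iff[OF mat_kernelD(1)[OF of_int_A_carrier x]] by auto
    then have "cramer_circuit f j $ l \<noteq> 0 \<or> v $ l \<noteq> 0" by (auto simp: x_index)
    then have "l \<in> vec_support (cramer_circuit f j) \<union> vec_support v"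
      using \<open>l < n\<close> in_vec_support_iff[OF dim(1)] in_vec_support_iff[OF dim(2)] by blast
    moreover have "x $ j = 0"
      using j by (simp add: x_index c_def cramer_circuit_index_self)
    then have "l \<noteq> j" using \<open>x $ l \<noteq> 0\<close> by blast
    ultimately show ?thesis using vec_support_cramer_circuit[of f j] v(2) by blast
  qed
  then have "x = 0\<^sub>v n"
    using indep_cols_basis[OF f] x A_carrier by (auto simp: indep_cols_def)
  then show ?thesis
    unfolding c_def[symmetric] using x_index dim by (intro eq_vecI) (auto simp: x_def)
qed

lemma ex_integral_circuit:
  assumes v: "v \<in> mat_kernel (of_int_mat A)" and j: "j \<in> vec_support v"
    and indep: "indep_cols (of_int_mat A) (vec_support v - {j})"
  obtains u c where "u \<in> mat_kernel A" and "c > 0" and "of_int_vec u = c \<cdot>\<^sub>v v"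
    and "l1_norm u \<le> (int m + 1) * Delta A"
proof -
  note dim = mat_kernelD(1)[OF of_int_A_carrier v]
  have jn: "j < n" "v $ j \<noteq> 0" using j in_vec_support_iff[OF dim] by auto
  have "vec_support v - {j} \<subseteq> {..<n}" using in_vec_support_iff[OF dim] by auto
  then obtain f where f: "f \<in> {..<m} \<rightarrow> {..<n}" "det (select_cols A f) \<noteq> 0"
    and supp: "vec_support v - {j} \<subseteq> f ` {..<m}"
    using indep_cols_extends_to_basis indep by blast
  have j_notin: "j \<notin> f ` {..<m}"
  proof
    assume "j \<in> f ` {..<m}"
    then have "vec_support v \<subseteq> f ` {..<m}" using supp by blast
    then have "v = 0\<^sub>v n" using indep_cols_basis[OF f] v A_carrier by (simp add: indep_cols_def)
    then show False using jn by simp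
  qed
  define c where "c = of_int (det (select_cols A f)) / v $ j"
  have w_eq: "of_int_vec (cramer_circuit f j) = c \<cdot>\<^sub>v v"
    unfolding c_def using supp
    by (intro cramer_circuit_eq_smult[OF f v _ jn(1) j_notin jn(2)]) blast
  show thesis
  proof
    let ?u = "(if c > 0 then 1 else - 1) \<cdot>\<^sub>v cramer_circuit f j"
    show "?u \<in> mat_kernel A"
      by (rule mat_kernel_smult[OF A_carrier cramer_circuit_in_mat_kernel[OF f(1) jn(1)]])
    show "\<bar>c\<bar> > 0" using f(2) jn by (simp add: c_def)
    show "of_int_vec ?u = \<bar>c\<bar> \<cdot>\<^sub>v v"
      using w_eq by (simp add: of_int_hom.vec_hom_smult smult_smult_assoc)
    have "l1_norm ?u = l1_norm (cramer_circuit f j)" by (simp add: l1_norm_def)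
    then show "l1_norm ?u \<le> (int m + 1) * Delta A"
      using l1_norm_cramer_circuit_le[OF f(1) jn(1)] by simp
  qed
qed

lemma ex_conformal_circuit_step:
  assumes d: "d \<in> mat_kernel (of_int_mat A)" "d \<noteq> 0\<^sub>v n"
  obtains u t k where "u \<in> mat_kernel A" and "l1_norm u \<le> (int m + 1) * Delta A"
    and "t \<ge> 0" and "conformal_le (t \<cdot>\<^sub>v of_int_vec u) d"
    and "vec_support (of_int_vec u) \<subseteq> vec_support d"
    and "k \<in> vec_support (of_int_vec u)" and "d $ k = t * of_int (u $ k)"
proof -
  obtain v j where v: "v \<in> mat_kernel (of_int_mat A)" "conformal v d" "j \<in> vec_support v"
    "indep_cols (of_int_mat A) (vec_support v - {j})"
    using ex_conformal_elementary[OF of_int_A_carrier d] by blast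
  obtain u c where u: "u \<in> mat_kernel A" "l1_norm u \<le> (int m + 1) * Delta A"
    and c: "c > 0" "of_int_vec u = c \<cdot>\<^sub>v v"
    using ex_integral_circuit[OF v(1,3,4)] by blast
  let ?u = "of_int_vec u"
  have supp: "vec_support ?u = vec_support v" using c by (auto simp: vec_support_def)
  have dims: "dim_vec ?u = dim_vec d" "dim_vec u = dim_vec d"
    using arg_cong[OF c(2), of dim_vec] v(2) by (auto simp: conformal_def)
  have conf: "conformal ?u d"
    using v(2) c(1) unfolding c(2) by (auto simp: conformal_def mult.assoc)
  obtain k t where k: "k \<in> vec_support ?u" "d $ k = t * ?u $ k"
    and le: "\<And>j. j < dim_vec d \<Longrightarrow> \<bar>t * ?u $ j\<bar> \<le> \<bar>d $ j\<bar>"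
    using ex_maximal_step[OF dims(1)] v(3) supp by blast
  have k': "k < dim_vec d" "?u $ k \<noteq> 0" using k(1) dims by (auto simp: vec_support_def)
  then have "0 < t * (?u $ k * ?u $ k)" using conf k(2) by (auto simp: conformal_def mult_ac)
  then have t: "t > 0" by (simp add: zero_less_mult_iff)
  show thesis
  proof
    have "conformal (t \<cdot>\<^sub>v ?u) d" using conf t by (auto simp: conformal_def mult.assoc)
    then show "conformal_le (t \<cdot>\<^sub>v ?u) d" by (rule conformal_le_if_conformal) (use le dims in simp)
    show "vec_support ?u \<subseteq> vec_support d" using conf by (force simp: conformal_def vec_support_def)
    show "d $ k = t * of_int (u $ k)" using k(2) k' dims by simp
  qed (use u t k in auto)
qed

lemma ex_conformal_circuit_split:
  assumes d: "d \<in> mat_kernel (of_int_mat A)" "d \<noteq> 0\<^sub>v n"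
    and T: "finite T" "indep_cols (of_int_mat A) (vec_support d - T)"
  obtains u t r where "u \<in> mat_kernel A" and "l1_norm u \<le> (int m + 1) * Delta A"
    and "t \<ge> 0" and "conformal_le (t \<cdot>\<^sub>v of_int_vec u) d"
    and "conformal_le (d - t \<cdot>\<^sub>v of_int_vec u) d"
    and "r \<in> T" and "indep_cols (of_int_mat A) (vec_support (d - t \<cdot>\<^sub>v of_int_vec u) - (T - {r}))"
proof -
  obtain u t k where u: "u \<in> mat_kernel A" "l1_norm u \<le> (int m + 1) * Delta A" "t \<ge> 0"
    "conformal_le (t \<cdot>\<^sub>v of_int_vec u) d" "vec_support (of_int_vec u) \<subseteq> vec_support d"
    and k: "k \<in> vec_support (of_int_vec u)" "d $ k = t * of_int (u $ k)"
    by (rule ex_conformal_circuit_step[OF d])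
  let ?u = "of_int_vec u"
  have u_ker: "?u \<in> mat_kernel (of_int_mat A)" by (rule of_int_vec_in_mat_kernel[OF A_carrier u(1)])
  note dim = mat_kernelD(1)[OF of_int_A_carrier d(1)] mat_kernelD(1)[OF of_int_A_carrier u_ker]
  have le: "conformal_le (d - t \<cdot>\<^sub>v ?u) d"
    using u(4) dim by (auto simp: conformal_le_def in_closed_segment_0_iff)
  have "vec_support (d - t \<cdot>\<^sub>v ?u) \<subseteq> vec_support d - {k}"
    using k(2) le dim by (fastforce simp: vec_support_def conformal_le_def)
  moreover obtain r where "r \<in> T" "indep_cols (of_int_mat A) (vec_support d - {k} - (T - {r}))"
    by (rule indep_cols_exchange[OF of_int_A_carrier T u_ker u(5) k(1)])
  ultimately show thesis
    using u le by (intro that) (auto elim: indep_cols_mono)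
qed

end

section \<open>Conformal rounding\<close>

lemma sum_floor_mult_bounds:
  fixes t x :: "'a \<Rightarrow> real"
  assumes "\<And>i. i \<in> I \<Longrightarrow> 0 \<le> t i" and "\<And>i. i \<in> I \<Longrightarrow> 0 \<le> t i * x i"
  shows "0 \<le> (\<Sum>i\<in>I. of_int \<lfloor>t i\<rfloor> * x i)"
    and "(\<Sum>i\<in>I. of_int \<lfloor>t i\<rfloor> * x i) \<le> (\<Sum>i\<in>I. t i * x i)"
proof -
  have "t i = 0 \<or> 0 \<le> x i" if "i \<in> I" for i
    using assms[OF that] by (auto simp: zero_le_mult_iff)
  then have "0 \<le> of_int \<lfloor>t i\<rfloor> * x i" "of_int \<lfloor>t i\<rfloor> * x i \<le> t i * x i" if "i \<in> I" for i
    using assms(1) that by (fastforce intro: mult_right_mono)+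
  then show "0 \<le> (\<Sum>i\<in>I. of_int \<lfloor>t i\<rfloor> * x i)"
    "(\<Sum>i\<in>I. of_int \<lfloor>t i\<rfloor> * x i) \<le> (\<Sum>i\<in>I. t i * x i)"
    by (simp_all add: sum_nonneg sum_mono)
qed

context full_row_rank
begin

definition conformal_decomposition ::
    "real vec \<Rightarrow> nat \<Rightarrow> (nat \<Rightarrow> real) \<Rightarrow> (nat \<Rightarrow> int vec) \<Rightarrow> bool" where
  "conformal_decomposition d q t u \<longleftrightarrow>
     (\<forall>i<q. t i \<ge> 0 \<and> u i \<in> mat_kernel A \<and> l1_norm (u i) \<le> (int m + 1) * Delta A \<and>
       conformal_le (t i \<cdot>\<^sub>v of_int_vec (u i)) d) \<and>
     (\<forall>j<n. d $ j = (\<Sum>i<q. t i * of_int (u i $ j)))"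

lemma ex_conformal_decomposition:
  assumes "d \<in> mat_kernel (of_int_mat A)"
    and "finite T" "card T \<le> q" "indep_cols (of_int_mat A) (vec_support d - T)"
  shows "\<exists>t u. conformal_decomposition d q t u"
  using assms
proof (induction q arbitrary: d T)
  case 0
  then have "d = 0\<^sub>v n" using A_carrier by (simp add: indep_cols_def)
  then show ?case by (simp add: conformal_decomposition_def)
next
  case (Suc q)
  show ?case
  proof (cases "d = 0\<^sub>v n")
    case True
    have "0\<^sub>v n \<in> mat_kernel A" using A_carrier by (intro mat_kernelI) auto
    then show ?thesis using True Delta_pos
      by (intro exI[of _ "\<lambda>_. 0"] exI[of _ "\<lambda>_. 0\<^sub>v n"])
         (auto simp: conformal_decomposition_def conformal_le_def l1_norm_def)
  next
    case False
    obtain v s r where v: "v \<in> mat_kernel A" "l1_norm v \<le> (int m + 1) * Delta A" "s \<ge> 0"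
      "conformal_le (s \<cdot>\<^sub>v of_int_vec v) d" "conformal_le (d - s \<cdot>\<^sub>v of_int_vec v) d"
      and r: "r \<in> T" "indep_cols (of_int_mat A) (vec_support (d - s \<cdot>\<^sub>v of_int_vec v) - (T - {r}))"
      by (rule ex_conformal_circuit_split[OF Suc.prems(1) False Suc.prems(2,4)])
    have v_ker: "of_int_vec v \<in> mat_kernel (of_int_mat A)"
      by (rule of_int_vec_in_mat_kernel[OF A_carrier v(1)])
    note dim = mat_kernelD(1)[OF of_int_A_carrier Suc.prems(1)]
      mat_kernelD(1)[OF of_int_A_carrier v_ker]
    define d' where "d' = d - s \<cdot>\<^sub>v of_int_vec v"
    have "d' \<in> mat_kernel (of_int_mat A)"
      unfolding d'_def by (rule mat_kernel_diff_smult[OF of_int_A_carrier Suc.prems(1) v_ker])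
    moreover have "card (T - {r}) \<le> q" using r(1) Suc.prems(2,3) by simp
    ultimately obtain t u where tu: "conformal_decomposition d' q t u"
      using Suc.IH[of d' "T - {r}"] Suc.prems(2) r(2) unfolding d'_def by blast
    have "d $ j = (\<Sum>i<Suc q. (t(q := s)) i * of_int ((u(q := v)) i $ j))" if "j < n" for j
    proof -
      have "d $ j = d' $ j + s * of_int (v $ j)" using that dim by (simp add: d'_def)
      then show ?thesis using tu that by (simp add: conformal_decomposition_def)
    qed
    then have "conformal_decomposition d (Suc q) (t(q := s)) (u(q := v))"
      using tu v conformal_le_trans[of _ d' d]
      by (auto simp: conformal_decomposition_def less_Suc_eq d'_def)
    then show ?thesis by blast
  qed
qed

lemma conformal_le_floor_sum:
  assumes decomp: "conformal_decomposition d q t u" and d: "d \<in> carrier_vec n"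
  shows "conformal_le (of_int_vec (vec n (\<lambda>j. \<Sum>i<q. \<lfloor>t i\<rfloor> * u i $ j))) d"
proof -
  have "(\<Sum>i<q. of_int \<lfloor>t i\<rfloor> * of_int (u i $ j)) \<in> closed_segment 0 (d $ j)" if j: "j < n" for j
  proof -
    have d_eq: "d $ j = (\<Sum>i<q. t i * of_int (u i $ j))"
      using decomp j by (simp add: conformal_decomposition_def)
    have t: "0 \<le> t i" if "i < q" for i using decomp that by (simp add: conformal_decomposition_def)
    have "t i * of_int (u i $ j) \<in> closed_segment 0 (d $ j)" if "i < q" for i
    proof -
      have "conformal_le (t i \<cdot>\<^sub>v of_int_vec (u i)) d" "u i \<in> carrier_vec n"
        using decomp that mat_kernelD(1)[OF A_carrier] by (auto simp: conformal_decomposition_def)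
      then show ?thesis using j d by (auto simp: conformal_le_def)
    qed
    then consider (nonneg) "\<forall>i<q. 0 \<le> t i * of_int (u i $ j)"
      | (nonpos) "\<forall>i<q. 0 \<le> t i * - of_int (u i $ j)"
      by (cases "0 \<le> d $ j") (force simp: in_closed_segment_0_iff)+
    then show ?thesis
    proof cases
      case nonneg
      then show ?thesis
        using sum_floor_mult_bounds[of "{..<q}" t "\<lambda>i. of_int (u i $ j)"] t
        by (simp add: d_eq in_closed_segment_0_iff)
    next
      case nonpos
      then show ?thesis
        using sum_floor_mult_bounds[of "{..<q}" t "\<lambda>i. - of_int (u i $ j)"] t
        by (simp add: d_eq in_closed_segment_0_iff sum_negf)
    qed
  qed
  then show ?thesis using d by (simp add: conformal_le_def)
qed

lemma l1_norm_diff_floor_sum_le: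
  assumes decomp: "conformal_decomposition d q t u" and d: "d \<in> carrier_vec n"
  shows "l1_norm (d - of_int_vec (vec n (\<lambda>j. \<Sum>i<q. \<lfloor>t i\<rfloor> * u i $ j)))
    \<le> (\<Sum>i<q. frac (t i) * of_int (l1_norm (u i)))"
proof -
  have d_eq: "d $ j = (\<Sum>i<q. t i * of_int (u i $ j))" if "j < n" for j
    using decomp that by (simp add: conformal_decomposition_def)
  have u: "u i \<in> carrier_vec n" if "i < q" for i
    using decomp that mat_kernelD(1)[OF A_carrier] by (simp add: conformal_decomposition_def)
  have "l1_norm (d - of_int_vec (vec n (\<lambda>j. \<Sum>i<q. \<lfloor>t i\<rfloor> * u i $ j)))
      = (\<Sum>j<n. \<bar>\<Sum>i<q. frac (t i) * of_int (u i $ j)\<bar>)"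
    unfolding l1_norm_def using d
    by (intro sum.cong) (auto simp: d_eq frac_def left_diff_distrib simp flip: sum_subtractf)
  also have "\<dots> \<le> (\<Sum>j<n. \<Sum>i<q. frac (t i) * \<bar>of_int (u i $ j)\<bar>)"
    by (intro sum_mono order_trans[OF sum_abs]) (simp add: abs_mult)
  also have "\<dots> = (\<Sum>i<q. frac (t i) * of_int (l1_norm (u i)))"
    by (subst sum.swap) (simp add: l1_norm_def sum_distrib_left carrier_vecD[OF u])
  finally show ?thesis .
qed

lemma ex_conformal_rounding:
  assumes d: "d \<in> mat_kernel (of_int_mat A)"
    and T: "finite T" "indep_cols (of_int_mat A) (vec_support d - T)"
    and R: "real (card T) * ((real m + 1) * of_int (Delta A)) \<le> R" "0 < R"
  obtains u where "u \<in> mat_kernel A" and "conformal_le (of_int_vec u) d"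
    and "l1_norm (d - of_int_vec u) < R"
proof -
  let ?M = "(real m + 1) * of_int (Delta A)"
  note dim = mat_kernelD(1)[OF of_int_A_carrier d]
  obtain t u where tu: "conformal_decomposition d (card T) t u"
    using ex_conformal_decomposition[OF d T(1) _ T(2)] by blast
  have u: "u i \<in> mat_kernel A" "real_of_int (l1_norm (u i)) \<le> ?M" if "i < card T" for i
  proof -
    have "u i \<in> mat_kernel A" "l1_norm (u i) \<le> (int m + 1) * Delta A"
      using tu that by (auto simp: conformal_decomposition_def)
    moreover from this(2) have "real_of_int (l1_norm (u i)) \<le> of_int ((int m + 1) * Delta A)"
      by (simp only: of_int_le_iff)
    ultimately show "u i \<in> mat_kernel A" "real_of_int (l1_norm (u i)) \<le> ?M" by simp_all
  qed
  let ?U = "vec n (\<lambda>j. \<Sum>i<card T. \<lfloor>t i\<rfloor> * u i $ j)"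
  have "frac (t i) * of_int (l1_norm (u i)) < ?M" if "i < card T" for i
  proof -
    have "frac (t i) * of_int (l1_norm (u i)) \<le> frac (t i) * ?M"
      using u(2)[OF that] by (intro mult_left_mono) auto
    also have "\<dots> < 1 * ?M" using Delta_pos frac_lt_1 by (intro mult_strict_right_mono) auto
    finally show ?thesis by simp
  qed
  then have "(\<Sum>i<card T. frac (t i) * of_int (l1_norm (u i))) < R"
    using R sum_strict_mono[of "{..<card T}" "\<lambda>i. frac (t i) * of_int (l1_norm (u i))" "\<lambda>_. ?M"]
    by (cases "card T = 0") (auto simp: lessThan_empty_iff)
  then have "l1_norm (d - of_int_vec ?U) < R"
    using l1_norm_diff_floor_sum_le[OF tu dim] by simp
  moreover have "?U \<in> mat_kernel A" using u(1) by (intro mat_kernel_sum[OF A_carrier]) auto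
  ultimately show thesis using conformal_le_floor_sum[OF tu dim] by (intro that)
qed

end

section \<open>Integer and linear programs\<close>

lemma mult_mat_vec_add_kernel:
  fixes A :: "'a::comm_ring_1 mat"
  assumes A: "A \<in> carrier_mat m n" and x: "x \<in> carrier_vec n" and y: "y \<in> mat_kernel A"
  shows "A *\<^sub>v (x + y) = A *\<^sub>v x"
  using mat_kernelD[OF A y] mult_mat_vec_carrier[OF A x]
  by (simp add: mult_add_distrib_mat_vec[OF A x])

lemma ip_feasible_add_kernel:
  assumes A: "A \<in> carrier_mat m n" and z: "ip_feasible A b z" and y: "y \<in> mat_kernel A"
    and nonneg: "\<And>j. j < n \<Longrightarrow> 0 \<le> z $ j + y $ j"
  shows "ip_feasible A b (z + y)"
  using z nonneg A mat_kernelD(1)[OF A y] mult_mat_vec_add_kernel[OF A _ y, of z]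
  by (auto simp: ip_feasible_def)

lemma lp_feasible_add_kernel:
  assumes A: "A \<in> carrier_mat m n" and x: "lp_feasible A b x" and y: "y \<in> mat_kernel (of_int_mat A)"
    and nonneg: "\<And>j. j < n \<Longrightarrow> 0 \<le> x $ j + y $ j"
  shows "lp_feasible A b (x + y)"
proof -
  have A': "of_int_mat A \<in> carrier_mat m n" using A by simp
  show ?thesis
    using x nonneg A mat_kernelD(1)[OF A' y] mult_mat_vec_add_kernel[OF A' _ y, of x]
    by (auto simp: lp_feasible_def)
qed

lemma lp_feasible_of_int:
  assumes A: "A \<in> carrier_mat m n" and z: "ip_feasible A b z"
  shows "lp_feasible A b (of_int_vec z)"
  using z A of_int_hom.mult_mat_vec_hom[OF A, of z, symmetric]
  by (auto simp: ip_feasible_def lp_feasible_def)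

lemma lp_feasible_diff_in_mat_kernel:
  assumes A: "A \<in> carrier_mat m n" and x: "lp_feasible A b x" and y: "lp_feasible A b y"
  shows "x - y \<in> mat_kernel (of_int_mat A)"
proof (rule mat_kernelI)
  show A': "of_int_mat A \<in> carrier_mat m n" using A by simp
  have dim: "x \<in> carrier_vec n" "y \<in> carrier_vec n" using x y A by (auto simp: lp_feasible_def)
  have "of_int_mat A *\<^sub>v x = of_int_mat A *\<^sub>v y" using x y by (simp add: lp_feasible_def)
  then show "of_int_mat A *\<^sub>v (x - y) = 0\<^sub>v m"
    using A' dim by (simp add: mult_minus_distrib_mat_vec[OF A' dim])
  show "x - y \<in> carrier_vec n" using dim by simp
qed

lemma ex_ip_optimal:
  assumes "\<exists>z. ip_feasible A b z" "ip_bounded A b c"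
  shows "\<exists>z. ip_optimal A b c z"
proof -
  obtain M where M: "\<And>z. ip_feasible A b z \<Longrightarrow> c \<bullet> z \<le> M"
    using assms(2) by (auto simp: ip_bounded_def)
  obtain z where z: "ip_feasible A b z"
    and least: "\<And>w. ip_feasible A b w \<Longrightarrow> nat (M - c \<bullet> z) \<le> nat (M - c \<bullet> w)"
    using assms(1) ex_has_least_nat[of "ip_feasible A b" _ "\<lambda>z. nat (M - c \<bullet> z)"] by blast
  have "c \<bullet> w \<le> c \<bullet> z" if "ip_feasible A b w" for w
    using least[OF that] M[OF that] M[OF z] by linarith
  then show ?thesis using z by (auto simp: ip_optimal_def)
qed

text \<open>As \<open>z - y\<close> is feasible as well, adding \<open>y\<close> cannot decrease the objective.\<close>

lemma ip_optimal_add_kernel: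
  assumes A: "A \<in> carrier_mat m n" and c: "c \<in> carrier_vec n" and z: "ip_optimal A b c z"
    and y: "y \<in> mat_kernel A" "\<And>j. j < n \<Longrightarrow> \<bar>y $ j\<bar> \<le> z $ j"
  shows "ip_optimal A b c (z + y)"
proof -
  have feas: "ip_feasible A b z" using z by (simp add: ip_optimal_def)
  have dim: "z \<in> carrier_vec n" "y \<in> carrier_vec n"
    using feas A mat_kernelD(1)[OF A y(1)] by (auto simp: ip_feasible_def)
  have bounds: "0 \<le> z $ j + y $ j" "0 \<le> z $ j - y $ j" if "j < n" for j
    using y(2)[OF that] by linarith+
  have "ip_feasible A b (z + (- 1) \<cdot>\<^sub>v y)"
    using bounds(2) dim
    by (intro ip_feasible_add_kernel[OF A feas mat_kernel_smult[OF A y(1)]]) simp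
  then have "c \<bullet> (z + (- 1) \<cdot>\<^sub>v y) \<le> c \<bullet> z" using z by (simp add: ip_optimal_def)
  then have "c \<bullet> z \<le> c \<bullet> (z + y)"
    using c dim scalar_prod_add_distrib[of c n z] by simp
  moreover have "ip_feasible A b (z + y)"
    using bounds(1) by (intro ip_feasible_add_kernel[OF A feas y(1)])
  ultimately show ?thesis using z unfolding ip_optimal_def by (meson order_trans)
qed

lemma ip_optimal_smaller_support:
  assumes A: "A \<in> carrier_mat m n" and c: "c \<in> carrier_vec n" and z: "ip_optimal A b c z"
    and y: "y \<in> mat_kernel A" "y \<noteq> 0\<^sub>v n" "vec_support y \<subseteq> vec_support z" "\<And>j. j < n \<Longrightarrow> \<bar>y $ j\<bar> \<le> 1"
  obtains w where "ip_optimal A b c w" and "vec_support w \<subset> vec_support z"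
proof -
  have dim: "z \<in> carrier_vec n" "y \<in> carrier_vec n" and nonneg: "\<And>j. j < n \<Longrightarrow> 0 \<le> z $ j"
    using z A mat_kernelD(1)[OF A y(1)] by (auto simp: ip_optimal_def ip_feasible_def)
  let ?z = "of_int_vec z" and ?y = "of_int_vec y"
  have "vec_support ?y \<noteq> {}" using y(2) vec_support_empty_iff[of ?y n] dim by simp
  then obtain k s where k: "k \<in> vec_support ?y" "?z $ k = s * ?y $ k"
    and le: "\<And>j. j < dim_vec ?z \<Longrightarrow> \<bar>s * ?y $ j\<bar> \<le> \<bar>?z $ j\<bar>"
    using ex_maximal_step[of ?y ?z] dim by auto
  have kn: "k < n" "y $ k \<noteq> 0" using k(1) dim by (auto simp: vec_support_def)
  then have "y $ k = 1 \<or> y $ k = - 1" using y(4)[of k] by linarith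
  then have s: "s = of_int (z $ k * y $ k)" and sq: "y $ k * y $ k = 1" using k(2) kn dim by auto
  define t where "t = - (z $ k * y $ k)"
  have t_le: "\<bar>t * y $ j\<bar> \<le> z $ j" if "j < n" for j
  proof -
    have "real_of_int \<bar>t * y $ j\<bar> \<le> of_int (z $ j)"
      using le[of j] nonneg[OF that] that dim by (simp add: s t_def abs_mult)
    then show ?thesis by (simp only: of_int_le_iff)
  qed
  have "ip_optimal A b c (z + t \<cdot>\<^sub>v y)"
    using t_le dim by (intro ip_optimal_add_kernel[OF A c z mat_kernel_smult[OF A y(1)]]) simp
  moreover have "vec_support (z + t \<cdot>\<^sub>v y) \<subset> vec_support z"
  proof -
    have "k \<in> vec_support z - vec_support (z + t \<cdot>\<^sub>v y)"
      using kn y(3) sq dim by (auto simp: vec_support_def t_def mult.assoc)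
    moreover have "vec_support (z + t \<cdot>\<^sub>v y) \<subseteq> vec_support z"
      using t_le dim by (force simp: vec_support_def)
    ultimately show ?thesis by blast
  qed
  ultimately show thesis by (rule that)
qed

lemma ex_signed_kernel_vec_if_not_distinct_subset_sums:
  assumes A: "A \<in> carrier_mat m n" and S: "S \<subseteq> {..<n}" "\<not> distinct_subset_sums A S"
  obtains y where "y \<in> mat_kernel A" and "y \<noteq> 0\<^sub>v n" and "vec_support y \<subseteq> S"
    and "\<And>j. j < n \<Longrightarrow> \<bar>y $ j\<bar> \<le> 1"
proof -
  obtain X Y where XY: "X \<subseteq> S" "Y \<subseteq> S" "X \<noteq> Y"
    and eq: "A *\<^sub>v vec n (indicator X) = A *\<^sub>v vec n (indicator Y)"
    using S(2) A by (auto simp: distinct_subset_sums_def inj_on_def)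
  define y :: "int vec" where "y = vec n (indicator X) - vec n (indicator Y)"
  have y_index: "y $ j = indicator X j - indicator Y j" if "j < n" for j
    using that by (simp add: y_def)
  show thesis
  proof
    show "y \<in> mat_kernel A"
      unfolding y_def using eq A
      by (intro mat_kernelI[OF A]) (auto simp: mult_minus_distrib_mat_vec[OF A])
    obtain j where j: "j \<in> X \<longleftrightarrow> j \<notin> Y" using XY(3) by blast
    then have "j < n" using XY(1,2) S(1) by blast
    then have "y $ j \<noteq> 0" using j by (auto simp: y_index)
    then show "y \<noteq> 0\<^sub>v n" using \<open>j < n\<close> by auto
    show "vec_support y \<subseteq> S"
    proof
      fix j assume "j \<in> vec_support y"
      then have "j < n" "y $ j \<noteq> 0" by (auto simp: vec_support_def y_def)
      then have "j \<in> X \<or> j \<in> Y" by (auto simp: y_index split: split_indicator_asm)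
      then show "j \<in> S" using XY(1,2) by blast
    qed
    show "\<bar>y $ j\<bar> \<le> 1" if "j < n" for j by (simp add: y_index[OF that] indicator_def)
  qed
qed

lemma ex_ip_optimal_distinct_subset_sums:
  assumes A: "A \<in> carrier_mat m n" and c: "c \<in> carrier_vec n"
    and "\<exists>z. ip_feasible A b z" "ip_bounded A b c"
  obtains z where "ip_optimal A b c z" and "distinct_subset_sums A (vec_support z)"
proof -
  obtain z where z: "ip_optimal A b c z"
    and min: "\<And>w. ip_optimal A b c w \<Longrightarrow> card (vec_support z) \<le> card (vec_support w)"
    using ex_ip_optimal[OF assms(3,4)]
      ex_has_least_nat[of "ip_optimal A b c" _ "\<lambda>z. card (vec_support z)"] by blast
  have "distinct_subset_sums A (vec_support z)"
  proof (rule ccontr)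
    have "vec_support z \<subseteq> {..<n}"
      using z A by (auto simp: ip_optimal_def ip_feasible_def vec_support_def)
    moreover assume "\<not> distinct_subset_sums A (vec_support z)"
    ultimately obtain y where "y \<in> mat_kernel A" "y \<noteq> 0\<^sub>v n" "vec_support y \<subseteq> vec_support z"
      "\<And>j. j < n \<Longrightarrow> \<bar>y $ j\<bar> \<le> 1"
      using ex_signed_kernel_vec_if_not_distinct_subset_sums[OF A] by blast
    then obtain w where "ip_optimal A b c w" "vec_support w \<subset> vec_support z"
      using ip_optimal_smaller_support[OF A c z] by blast
    then show False using min[of w] psubset_card_mono[OF finite_vec_support] by (metis not_less)
  qed
  with z show thesis by (rule that)
qed

lemma lp_vertex_indep_support:
  assumes A: "A \<in> carrier_mat m n" and x: "lp_vertex A b x"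
  shows "indep_cols (of_int_mat A) (vec_support x)"
  unfolding indep_cols_def
proof (intro ballI impI)
  let ?A = "of_int_mat A"
  have A': "?A \<in> carrier_mat m n" using A by simp
  fix v assume v: "v \<in> mat_kernel ?A" "vec_support v \<subseteq> vec_support x"
  have feas: "lp_feasible A b x" using x by (simp add: lp_vertex_def)
  have dim: "x \<in> carrier_vec n" "v \<in> carrier_vec n" and nonneg: "\<And>j. j < n \<Longrightarrow> 0 \<le> x $ j"
    using feas A mat_kernelD(1)[OF A' v(1)] by (auto simp: lp_feasible_def)
  show "v = 0\<^sub>v (dim_col ?A)"
  proof (rule ccontr)
    assume "v \<noteq> 0\<^sub>v (dim_col ?A)"
    then have "vec_support v \<noteq> {}" using vec_support_empty_iff[OF dim(2)] A by simp
    then obtain k t where k: "k \<in> vec_support v" "x $ k = t * v $ k"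
      and le: "\<And>j. j < n \<Longrightarrow> \<bar>t * v $ j\<bar> \<le> x $ j"
      using ex_maximal_step[of v x] dim nonneg by (metis abs_of_nonneg carrier_vecD)
    have feas_y: "lp_feasible A b (x + s \<cdot>\<^sub>v v)" if "\<bar>s\<bar> = \<bar>t\<bar>" for s
    proof (rule lp_feasible_add_kernel[OF A feas mat_kernel_smult[OF A' v(1)]])
      fix j assume j: "j < n"
      have "\<bar>s * v $ j\<bar> \<le> x $ j" using le[OF j] that by (simp add: abs_mult)
      then show "0 \<le> x $ j + (s \<cdot>\<^sub>v v) $ j" using j dim by simp
    qed
    have "k < n" "x $ k \<noteq> 0" using k(1) v(2) in_vec_support_iff[OF dim(1)] by blast+
    then have "(x + t \<cdot>\<^sub>v v) $ k \<noteq> (x + (- t) \<cdot>\<^sub>v v) $ k" using k(2) dim by simp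
    then have "x + t \<cdot>\<^sub>v v \<noteq> x + (- t) \<cdot>\<^sub>v v" by metis
    moreover have "x = (1/2) \<cdot>\<^sub>v (x + t \<cdot>\<^sub>v v) + (1 - 1/2) \<cdot>\<^sub>v (x + (- t) \<cdot>\<^sub>v v)"
      using dim by (intro eq_vecI) (auto simp: field_simps)
    moreover have "(0::real) < 1/2" "1/2 < (1::real)" by simp_all
    ultimately show False
      using x feas_y[of t] feas_y[of "- t"] unfolding lp_vertex_def by (metis abs_minus_cancel)
  qed
qed

text \<open>Both \<open>z + u\<close> and \<open>x - u\<close> are feasible, so optimality of \<open>x\<close> forces \<open>c \<bullet> u \<ge> 0\<close>.\<close>

lemma ip_optimal_add_conformal:
  assumes A: "A \<in> carrier_mat m n" and c: "c \<in> carrier_vec n"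
    and z: "ip_optimal A b c z" and x: "lp_optimal A b c x"
    and u: "u \<in> mat_kernel A" "conformal_le (of_int_vec u) (x - of_int_vec z)"
  shows "ip_optimal A b c (z + u)"
proof -
  let ?A = "of_int_mat A" and ?u = "of_int_vec u" and ?c = "of_int_vec c"
  have A': "?A \<in> carrier_mat m n" using A by simp
  have feas: "ip_feasible A b z" "lp_feasible A b x"
    using z x by (simp_all add: ip_optimal_def lp_optimal_def)
  then have dim: "z \<in> carrier_vec n" "x \<in> carrier_vec n" "u \<in> carrier_vec n"
    and nonneg: "\<And>j. j < n \<Longrightarrow> 0 \<le> z $ j" "\<And>j. j < n \<Longrightarrow> 0 \<le> x $ j"
    using A mat_kernelD(1)[OF A u(1)] by (auto simp: ip_feasible_def lp_feasible_def)
  have bounds: "0 \<le> real_of_int (z $ j + u $ j)" "0 \<le> x $ j - of_int (u $ j)" if "j < n" for j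
    using u(2) nonneg[OF that] that dim by (auto simp: conformal_le_def in_closed_segment_0_iff)
  have "ip_feasible A b (z + u)"
    using bounds(1)
    by (intro ip_feasible_add_kernel[OF A feas(1) u(1)]) (simp only: of_int_0_le_iff)
  moreover have "lp_feasible A b (x + (- 1) \<cdot>\<^sub>v ?u)"
    using bounds(2) dim mat_kernel_smult[OF A' of_int_vec_in_mat_kernel[OF A u(1)]]
    by (intro lp_feasible_add_kernel[OF A feas(2)]) auto
  then have "?c \<bullet> (x + (- 1) \<cdot>\<^sub>v ?u) \<le> ?c \<bullet> x" using x by (simp add: lp_optimal_def)
  then have "0 \<le> ?c \<bullet> ?u" using c dim scalar_prod_add_distrib[of ?c n x] by simp
  then have "0 \<le> c \<bullet> u" using c dim by (simp add: scalar_prod_def flip: of_int_mult of_int_sum)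
  then have "c \<bullet> z \<le> c \<bullet> (z + u)" using c dim by (simp add: scalar_prod_add_distrib[of c n])
  ultimately show ?thesis using z unfolding ip_optimal_def by (meson order_trans)
qed

lemma l1_dist_eq_l1_norm:
  assumes "z \<in> carrier_vec n" "u \<in> carrier_vec n" "x \<in> carrier_vec n"
  shows "l1_dist (z + u) x = l1_norm (x - of_int_vec z - of_int_vec u)"
  using assms by (auto simp: l1_dist_def l1_norm_def abs_if intro!: sum.cong)

lemma (in full_row_rank) ex_kernel_vec_near_vertex:
  assumes "m \<ge> 1" and z: "ip_feasible A b z" "distinct_subset_sums A (vec_support z)"
    and x: "lp_vertex A b x"
  obtains u where "u \<in> mat_kernel A" and "conformal_le (of_int_vec u) (x - of_int_vec z)"
    and "l1_norm (x - of_int_vec z - of_int_vec u) <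
      3 * real m ^ 2 * log_factor m (Delta A) * of_int (Delta A)"
proof -
  let ?d = "x - of_int_vec z" and ?T = "vec_support z"
    and ?R = "3 * real m ^ 2 * log_factor m (Delta A) * of_int (Delta A)"
  have feas: "lp_feasible A b x" using x by (simp add: lp_vertex_def)
  have dim: "z \<in> carrier_vec n" "x \<in> carrier_vec n"
    using z(1) feas A_carrier by (auto simp: ip_feasible_def lp_feasible_def)
  have ker: "?d \<in> mat_kernel (of_int_mat A)"
    using feas lp_feasible_of_int[OF A_carrier z(1)]
    by (rule lp_feasible_diff_in_mat_kernel[OF A_carrier])
  have "vec_support ?d - ?T \<subseteq> vec_support x" using dim by (auto simp: vec_support_def)
  with lp_vertex_indep_support[OF A_carrier x]
  have indep: "indep_cols (of_int_mat A) (vec_support ?d - ?T)" by (rule indep_cols_mono)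
  have "real (card ?T) * (real m + 1) \<le> 3 * real m ^ 2 * log_factor m (Delta A)"
    using assms(1) z(2) in_vec_support_iff[OF dim(1)] by (intro card_distinct_subset_sums_le) auto
  then have bound: "real (card ?T) * ((real m + 1) * of_int (Delta A)) \<le> ?R"
    unfolding mult.assoc[of "real (card ?T)", symmetric] using Delta_pos
    by (intro mult_right_mono) auto
  have "0 < ?R" using assms(1) log_factor_ge_1[of m "Delta A"] Delta_pos by simp
  then show thesis
    using ex_conformal_rounding[OF ker finite_vec_support indep bound] that by blast
qed

theorem theorem1:
  fixes A :: "int mat" and b c :: "int vec" and m n :: nat and xs :: "real vec"
  assumes "A \<in> carrier_mat m n" and "b \<in> carrier_vec m" and "c \<in> carrier_vec n"
    and "m \<ge> 1"
    and "vec_space.rank m (map_mat real_of_int A) = m"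
    and "\<exists>z. ip_feasible A b z"
    and "ip_bounded A b c"
    and "lp_vertex A b xs" and "lp_optimal A b c xs"
  shows "\<exists>zs. ip_optimal A b c zs \<and>
     l1_dist zs xs < 3 * real m ^ 2 *
        log 2 (2 * sqrt (real m) * real_of_int (Delta A) powr (1 / real m)) * real_of_int (Delta A)"
proof -
  interpret full_row_rank A m n using assms(1,5) by unfold_locales
  obtain z where z: "ip_optimal A b c z" and distinct: "distinct_subset_sums A (vec_support z)"
    using ex_ip_optimal_distinct_subset_sums[OF assms(1,3,6,7)] by blast
  have feas: "ip_feasible A b z" using z by (simp add: ip_optimal_def)
  obtain u where u: "u \<in> mat_kernel A"
    and conf: "conformal_le (of_int_vec u) (xs - of_int_vec z)"
    and close: "l1_norm (xs - of_int_vec z - of_int_vec u) <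
      3 * real m ^ 2 * log_factor m (Delta A) * of_int (Delta A)"
    by (rule ex_kernel_vec_near_vertex[OF assms(4) feas distinct assms(8)])
  have "z \<in> carrier_vec n" "u \<in> carrier_vec n" "xs \<in> carrier_vec n"
    using feas mat_kernelD(1)[OF assms(1) u] assms(1,8)
    by (auto simp: ip_feasible_def lp_vertex_def lp_feasible_def)
  then have "l1_dist (z + u) xs = l1_norm (xs - of_int_vec z - of_int_vec u)"
    by (rule l1_dist_eq_l1_norm)
  moreover have "ip_optimal A b c (z + u)"
    by (rule ip_optimal_add_conformal[OF assms(1,3) z assms(9) u conf])
  ultimately show ?thesis using close unfolding log_factor_def by auto
qed

end
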